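(* \textsc{$\alpha$-Globally Optimal Assignment} is W[1]-hard with respect to the parameter $k=m+\alpha$.
   Context: An instance of \textsc{$\alpha$-Globally Optimal Assignment} is a tuple $(A,I,P_1,\ldots,P_\ell,\alpha)$ where $A$ is a set of $n$ agents, $I$ is a set of $m$ items, $\alpha\in\{1,\ldots,\ell\}$, and for each layer $j\in\{1,\ldots,\ell\}$ the preference profile $P_j$ assigns to every agent $a$ a preference list $<^{(j)}_a$, which is a strict linear order over a subset of $I$ (the items acceptable to $a$ in layer $j$; lists may be incomplete). A special item $b_\emptyset\notin I$ is regarded as the least preferred item of every agent. An assignment is a map $p:A\to I\cup\{b_\emptyset\}$ such that no item of $I$ is assigned to two different agents; it is legal in layer $j$ if every agent receives either $b_\emptyset$ or an item acceptable to it in layer $j$. A legal assignment $p$ is Pareto optimal in layer $j$ if there is no other legal assignment $q$ (for layer $j$) with $p(a)\le^{(j)}_a q(a)$ for all $a\in A$ and $p(a)<^{(j)}_a q(a)$ for some $a\in A$. An assignment is $\alpha$-globally optimal if there exist $\alpha$ distinct layers in each of which it is Pareto optimal. The problem asks whether an $\alpha$-globally optimal assignment exists. *)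

theory Defs
  imports Main
begin

section \<open>Computation model\<close>

text \<open>
  Algorithms are programs of the imperative WHILE language over binary trees (N. D. Jones,
  Computability and Complexity from a Programming Perspective). Instances, which the
  literature writes as strings over a finite alphabet, are binary trees.
  An assignment is charged the size of the tree that it stores, not a unit:
  with unit cost, repeating \<open>x := (x, x)\<close> would build trees of exponential
  size in linear time. With this charge, running times agree with those of Turing machines
  up to a polynomial.
\<close>

datatype data = Lf | Br data data

text \<open>
  The size counts leaves too, so that it is never 0 and a bound \<open>f k * tsize x ^ e\<close> is never
  void.
\<close>

fun tsize :: "data \<Rightarrow> nat" where
  "tsize Lf = 1"
| "tsize (Br x y) = 1 + tsize x + tsize y"

type_synonym vname = nat
type_synonym state = "vname \<Rightarrow> data"

datatype expr = Var vname | Leaf | Pair expr expr | Left expr | Right expr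

fun left :: "data \<Rightarrow> data" where
  "left Lf = Lf"
| "left (Br x y) = x"

fun right :: "data \<Rightarrow> data" where
  "right Lf = Lf"
| "right (Br x y) = y"

fun eval :: "expr \<Rightarrow> state \<Rightarrow> data" where
  "eval (Var v) s = s v"
| "eval Leaf s = Lf"
| "eval (Pair e e') s = Br (eval e s) (eval e' s)"
| "eval (Left e) s = left (eval e s)"
| "eval (Right e) s = right (eval e s)"

datatype com =
    Skip
  | Assign vname expr
  | Seq com com
  | Cond vname com com
  | While vname com

text \<open>\<open>exec c s t s'\<close>: started in \<open>s\<close>, program \<open>c\<close> halts in \<open>s'\<close> after time \<open>t\<close>. A leaf
  is the truth value false.\<close>

inductive exec :: "com \<Rightarrow> state \<Rightarrow> nat \<Rightarrow> state \<Rightarrow> bool" where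
  Skip: "exec Skip s 1 s"
| Assign: "exec (Assign v e) s (1 + tsize (eval e s)) (s(v := eval e s))"
| Seq: "exec c s t s' \<Longrightarrow> exec c' s' t' s'' \<Longrightarrow> exec (Seq c c') s (t + t') s''"
| CondTrue: "s v \<noteq> Lf \<Longrightarrow> exec c s t s' \<Longrightarrow> exec (Cond v c c') s (1 + t) s'"
| CondFalse: "s v = Lf \<Longrightarrow> exec c' s t s' \<Longrightarrow> exec (Cond v c c') s (1 + t) s'"
| WhileFalse: "s v = Lf \<Longrightarrow> exec (While v c) s 1 s"
| WhileTrue: "s v \<noteq> Lf \<Longrightarrow> exec c s t s' \<Longrightarrow> exec (While v c) s' t' s'' \<Longrightarrow>
    exec (While v c) s (1 + t + t') s''"

text \<open>Input and output are held in variable 0; all other variables are initially empty.\<close>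

definition computes_in :: "com \<Rightarrow> data \<Rightarrow> nat \<Rightarrow> data \<Rightarrow> bool" where
  "computes_in c x t y \<longleftrightarrow> (\<exists>s. exec c ((\<lambda>_. Lf)(0 := x)) t s \<and> s 0 = y)"


section \<open>Encodings\<close>

text \<open>
  Numbers are encoded in unary. In the instances below every number is the weight bound,
  the parameter, or at most the length of some listed object, so binary encoding would
  give the same parameterized problems up to fpt-reductions.
\<close>

fun enc_nat :: "nat \<Rightarrow> data" where
  "enc_nat 0 = Lf"
| "enc_nat (Suc n) = Br Lf (enc_nat n)"

fun enc_list :: "('a \<Rightarrow> data) \<Rightarrow> 'a list \<Rightarrow> data" where
  "enc_list enc [] = Lf"
| "enc_list enc (x # xs) = Br (enc x) (enc_list enc xs)"


section \<open>Parameterized problems and reductions\<close>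

type_synonym param_problem = "(data \<times> nat) set"

definition computable :: "(nat \<Rightarrow> nat) \<Rightarrow> bool" where
  "computable f \<longleftrightarrow> (\<exists>c. \<forall>n. \<exists>t. computes_in c (enc_nat n) t (enc_nat (f n)))"

definition fpt_reducible :: "param_problem \<Rightarrow> param_problem \<Rightarrow> bool"  (infix "\<le>\<^sub>f\<^sub>p\<^sub>t" 50) where
  "P \<le>\<^sub>f\<^sub>p\<^sub>t Q \<longleftrightarrow> (\<exists>c f g e. computable f \<and> computable g \<and>
     (\<forall>x k. \<exists>x' k' t.
        computes_in c (Br x (enc_nat k)) t (Br x' (enc_nat k')) \<and>
        t \<le> f k * tsize x ^ e \<and>
        k' \<le> g k \<and>
        ((x, k) \<in> P \<longleftrightarrow> (x', k') \<in> Q)))"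


section \<open>Boolean circuits and the W-hierarchy\<close>

datatype gate = Input | Neg nat | Conj "nat list" | Disj "nat list"

fun preds :: "gate \<Rightarrow> nat list" where
  "preds Input = []"
| "preds (Neg j) = [j]"
| "preds (Conj js) = js"
| "preds (Disj js) = js"

text \<open>A circuit is a directed acyclic graph, given as the list of its nodes in a topological
  order whose last node is the output node.\<close>

type_synonym circuit = "gate list"

fun fan_in_ok :: "gate \<Rightarrow> bool" where
  "fan_in_ok Input = True"
| "fan_in_ok (Neg j) = True"
| "fan_in_ok (Conj js) = (2 \<le> length js)"
| "fan_in_ok (Disj js) = (2 \<le> length js)"

definition wf_circuit :: "circuit \<Rightarrow> bool" where
  "wf_circuit C \<longleftrightarrow> C \<noteq> [] \<and>
     (\<forall>i < length C. fan_in_ok (C ! i) \<and> distinct (preds (C ! i)) \<and>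
        (\<forall>j \<in> set (preds (C ! i)). j < i))"

definition input_nodes :: "circuit \<Rightarrow> nat set" where
  "input_nodes C = {i. i < length C \<and> C ! i = Input}"

definition output_node :: "circuit \<Rightarrow> nat" where
  "output_node C = length C - 1"

text \<open>Value of node \<open>i\<close> when exactly the input nodes in \<open>S\<close> are set to true. The guards
  \<open>j < i\<close> are only there for termination; they hold in well-formed circuits.\<close>

fun node_value :: "circuit \<Rightarrow> nat set \<Rightarrow> nat \<Rightarrow> bool" where
  "node_value C S i = (case C ! i of
      Input \<Rightarrow> i \<in> S
    | Neg j \<Rightarrow> (if j < i then \<not> node_value C S j else False)
    | Conj js \<Rightarrow> (\<forall>j \<in> {j \<in> set js. j < i}. node_value C S j)
    | Disj js \<Rightarrow> (\<exists>j \<in> {j \<in> set js. j < i}. node_value C S j))"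

declare node_value.simps [simp del]

definition weighted_satisfiable :: "circuit \<Rightarrow> nat \<Rightarrow> bool" where
  "weighted_satisfiable C k \<longleftrightarrow>
     (\<exists>S \<subseteq> input_nodes C. card S = k \<and> node_value C S (output_node C))"

definition input_output_path :: "circuit \<Rightarrow> nat list \<Rightarrow> bool" where
  "input_output_path C p \<longleftrightarrow> p \<noteq> [] \<and> hd p \<in> input_nodes C \<and> last p = output_node C \<and>
     successively (\<lambda>i j. j < length C \<and> i \<in> set (preds (C ! j))) p"

definition large :: "gate \<Rightarrow> bool" where
  "large g \<longleftrightarrow> 2 < length (preds g)"

definition depth_at_most :: "nat \<Rightarrow> circuit \<Rightarrow> bool" where
  "depth_at_most d C \<longleftrightarrow> (\<forall>p. input_output_path C p \<longrightarrow> length p - 1 \<le> d)"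

definition weft_at_most :: "nat \<Rightarrow> circuit \<Rightarrow> bool" where
  "weft_at_most w C \<longleftrightarrow>
     (\<forall>p. input_output_path C p \<longrightarrow> length (filter (\<lambda>i. large (C ! i)) p) \<le> w)"

fun enc_gate :: "gate \<Rightarrow> data" where
  "enc_gate Input = Br (enc_nat 0) Lf"
| "enc_gate (Neg j) = Br (enc_nat 1) (enc_nat j)"
| "enc_gate (Conj js) = Br (enc_nat 2) (enc_list enc_nat js)"
| "enc_gate (Disj js) = Br (enc_nat 3) (enc_list enc_nat js)"

definition weighted_circuit_sat :: "nat \<Rightarrow> nat \<Rightarrow> param_problem" where
  "weighted_circuit_sat w d = {(enc_list enc_gate C, k) | C k.
     wf_circuit C \<and> weft_at_most w C \<and> depth_at_most d C \<and> weighted_satisfiable C k}"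

definition W_class :: "nat \<Rightarrow> param_problem set" where
  "W_class w = {P. \<exists>d \<ge> 1. P \<le>\<^sub>f\<^sub>p\<^sub>t weighted_circuit_sat w d}"

definition W_hard :: "nat \<Rightarrow> param_problem \<Rightarrow> bool" where
  "W_hard w Q \<longleftrightarrow> (\<forall>P \<in> W_class w. P \<le>\<^sub>f\<^sub>p\<^sub>t Q)"


section \<open>Globally optimal assignment\<close>

text \<open>A strict linear order over a subset of the items is given by the list of
  that subset from the most preferred to the least preferred item. Layers are numbered
  from 0.\<close>

record ('a, 'b) goa =
  agents :: "'a set"
  items :: "'b set"
  layers :: "('a \<Rightarrow> 'b list) list"
  alpha :: nat

definition goa_instance :: "('a, 'b) goa \<Rightarrow> bool" where
  "goa_instance G \<longleftrightarrow> finite (agents G) \<and> finite (items G) \<and>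
     (\<forall>P \<in> set (layers G). \<forall>a \<in> agents G. distinct (P a) \<and> set (P a) \<subseteq> items G) \<and>
     1 \<le> alpha G \<and> alpha G \<le> length (layers G)"

text \<open>The value \<open>None\<close> stands for the special item that is less preferred than every
  acceptable item. \<open>less_pref xs y z\<close>: an agent with preference list \<open>xs\<close> prefers \<open>z\<close> to \<open>y\<close>.\<close>

fun less_pref :: "'b list \<Rightarrow> 'b option \<Rightarrow> 'b option \<Rightarrow> bool" where
  "less_pref xs y None \<longleftrightarrow> False"
| "less_pref xs None (Some z) \<longleftrightarrow> z \<in> set xs"
| "less_pref xs (Some y) (Some z) \<longleftrightarrow>
     (\<exists>i j. i < j \<and> j < length xs \<and> xs ! i = z \<and> xs ! j = y)"

definition assignment :: "('a, 'b) goa \<Rightarrow> ('a \<Rightarrow> 'b option) \<Rightarrow> bool" where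
  "assignment G p \<longleftrightarrow> (\<forall>a \<in> agents G. set_option (p a) \<subseteq> items G) \<and>
     (\<forall>a \<in> agents G. \<forall>a' \<in> agents G. p a \<noteq> None \<and> p a = p a' \<longrightarrow> a = a')"

definition legal :: "('a, 'b) goa \<Rightarrow> nat \<Rightarrow> ('a \<Rightarrow> 'b option) \<Rightarrow> bool" where
  "legal G j p \<longleftrightarrow> assignment G p \<and> (\<forall>a \<in> agents G. set_option (p a) \<subseteq> set ((layers G ! j) a))"

definition pareto_optimal :: "('a, 'b) goa \<Rightarrow> nat \<Rightarrow> ('a \<Rightarrow> 'b option) \<Rightarrow> bool" where
  "pareto_optimal G j p \<longleftrightarrow> legal G j p \<and>
     \<not> (\<exists>q. legal G j q \<and>
          (\<forall>a \<in> agents G. p a = q a \<or> less_pref ((layers G ! j) a) (p a) (q a)) \<and>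
          (\<exists>a \<in> agents G. less_pref ((layers G ! j) a) (p a) (q a)))"

definition globally_optimal :: "('a, 'b) goa \<Rightarrow> ('a \<Rightarrow> 'b option) \<Rightarrow> bool" where
  "globally_optimal G p \<longleftrightarrow> assignment G p \<and>
     (\<exists>J \<subseteq> {..<length (layers G)}. card J = alpha G \<and> (\<forall>j \<in> J. pareto_optimal G j p))"

text \<open>Encoded instances have agents \<open>0, \<dots>, n - 1\<close> and items \<open>0, \<dots>, m - 1\<close>.\<close>

definition enc_goa :: "(nat, nat) goa \<Rightarrow> data" where
  "enc_goa G =
     Br (enc_nat (card (agents G)))
    (Br (enc_nat (card (items G)))
    (Br (enc_list (\<lambda>P. enc_list (\<lambda>a. enc_list enc_nat (P a)) [0..<card (agents G)]) (layers G))
        (enc_nat (alpha G))))"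

definition globally_optimal_assignment :: param_problem where
  "globally_optimal_assignment = {(enc_goa G, card (items G) + alpha G) | G.
     goa_instance G \<and> agents G = {..<card (agents G)} \<and> items G = {..<card (items G)} \<and>
     (\<exists>p. globally_optimal G p)}"

end

theory Submission
  imports Defs
begin

text \<open>
  Let \<open>C\<close> have weft 1 and depth \<open>d\<close>. After guessing, for each of the boundedly many
  large gates that need a witness, one predecessor, a false value of \<open>C\<close> is
  certified by at most \<open>2 ^ d\<close> input nodes. List the \<open>k\<close> true inputs in increasing order;
  each of the \<open>k + 1\<close> gaps between neighbours determines all inputs in it. So \<open>C\<close> is
  satisfied if and only if one can put gaps (with a common guess) into \<open>k + 1\<close> slots such
  that no \<open>2 ^ d\<close> of them are inconsistent or refute \<open>C\<close>. In the assignment problem, slots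
  are items, gaps with guesses are agents, and every admissible choice of gaps for a
  \<open>2 ^ d\<close>-tuple of slots is a layer. A layer is optimal only for assignments that make its
  choice, so an assignment is optimal in at most one layer per tuple of slots, and
  \<open>\<alpha> = (k + 1) ^ 2 ^ d\<close> demands one for each tuple. For fixed \<open>d\<close> all this is polynomial
  in the size of the instance and \<open>k\<close>.
\<close>

section \<open>Programs with restored workspace\<close>

text \<open>An input is false on account of all true inputs together, so no bounded part of a list
  of true inputs can certify this. A gap can, and this is why labels are gaps rather than single
  inputs. The second obstacle is a gate of unbounded fan-in that would need just one predecessor
  with the desired value: refuting it takes all its predecessors. The guess replaces them by one. As
  no other large gate lies on a path through this gate, the guessed predecessor is evaluated
  exactly. Only small gates with two predecessors still branch, which is the origin of
  \<open>2 ^ d\<close>. The class W[1] is given by circuits of every depth \<open>d\<close>, and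
  each \<open>d\<close> is treated directly, without a normal form; the degree of the polynomial
  grows with \<open>d\<close>, which is fixed before the reduction is chosen. Tuples of slots may
  repeat slots. So one tuple length expresses conditions on one slot, on two slots, or on up to
  \<open>2 ^ d\<close> of them. The number of tuples is then exactly \<open>alpha\<close>, and a
  pigeonhole argument turns "some \<open>alpha\<close> layers" into "one layer for every
  tuple".\<close>

fun expr_bound :: "expr \<Rightarrow> nat" where
  "expr_bound (Var v) = Suc v"
| "expr_bound Leaf = 0"
| "expr_bound (Pair e e') = max (expr_bound e) (expr_bound e')"
| "expr_bound (Left e) = expr_bound e"
| "expr_bound (Right e) = expr_bound e"

fun com_bound :: "com \<Rightarrow> nat" where
  "com_bound Skip = 0"
| "com_bound (Assign v e) = max (Suc v) (expr_bound e)"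
| "com_bound (Seq c c') = max (com_bound c) (com_bound c')"
| "com_bound (Cond v c c') = max (Suc v) (max (com_bound c) (com_bound c'))"
| "com_bound (While v c) = max (Suc v) (com_bound c)"

lemma eval_cong:
  "expr_bound e \<le> n \<Longrightarrow> (\<And>v. v < n \<Longrightarrow> r v = s v) \<Longrightarrow> eval e r = eval e s"
  by (induction e) auto

text \<open>Reads and writes stay below \<open>com_bound c\<close>, so a run can be replayed inside
  a larger memory. This lets a program known only through \<open>computes_in\<close> serve as a
  subprogram.\<close>

lemma exec_transfer:
  assumes "exec c s t s'" "com_bound c \<le> n" "\<And>v. v < n \<Longrightarrow> r v = s v"
  shows "exec c r t (\<lambda>v. if v < n then s' v else r v)"
  using assms
proof (induction arbitrary: r rule: exec.induct)
  case (Skip s)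
  then have "(\<lambda>v. if v < n then s v else r v) = r" by auto
  then show ?case using exec.Skip[of r] by simp
next
  case (Assign v e s)
  then have e: "eval e r = eval e s" by (intro eval_cong) auto
  have "(\<lambda>w. if w < n then (s(v := eval e s)) w else r w) = r(v := eval e r)"
    using Assign e by auto
  then show ?case using exec.Assign[of v e r] e by simp
next
  case (Seq c s t s' c' t' s'')
  let ?r = "\<lambda>v. if v < n then s' v else r v"
  have "exec c r t ?r" using Seq by auto
  moreover have "exec c' ?r t' (\<lambda>v. if v < n then s'' v else ?r v)"
    using Seq by auto
  moreover have "(\<lambda>v. if v < n then s'' v else ?r v) = (\<lambda>v. if v < n then s'' v else r v)" by auto
  ultimately show ?case by (simp add: exec.Seq)
next
  case (CondTrue s v c t s' c')
  then have "r v \<noteq> Lf" "exec c r t (\<lambda>v. if v < n then s' v else r v)" by auto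
  then show ?case by (rule exec.CondTrue)
next
  case (CondFalse s v c' t s' c)
  then have "r v = Lf" "exec c' r t (\<lambda>v. if v < n then s' v else r v)" by auto
  then show ?case by (rule exec.CondFalse)
next
  case (WhileFalse s v c)
  then have "(\<lambda>v. if v < n then s v else r v) = r" by auto
  moreover have "r v = Lf" using WhileFalse by auto
  ultimately show ?case using exec.WhileFalse[of r v c] by simp
next
  case (WhileTrue s v c t s' t' s'')
  let ?r = "\<lambda>v. if v < n then s' v else r v"
  have "exec c r t ?r" using WhileTrue by auto
  moreover have "exec (While v c) ?r t' (\<lambda>v. if v < n then s'' v else ?r v)"
    using WhileTrue by auto
  moreover have "(\<lambda>v. if v < n then s'' v else ?r v) = (\<lambda>v. if v < n then s'' v else r v)" by auto
  moreover have "r v \<noteq> Lf" using WhileTrue by auto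
  ultimately show ?case using exec.WhileTrue[of r v c t ?r t'] by simp
qed

text \<open>This is where the charge for stored trees enters: a fast program has a small output,
  which is needed whenever two programs are composed.\<close>

lemma exec_size: "exec c s t s' \<Longrightarrow> tsize (s' v) \<le> t + tsize (s v)"
  by (induction rule: exec.induct) (auto intro: le_trans)

text \<open>Calling convention for subprograms: variables 1 to \<open>N - 1\<close> are scratch
  space, empty on entry and again on exit, and all others except variable 0 survive. Programs can
  thus be nested by storing data in variables from \<open>N\<close> upwards.\<close>

definition does :: "com \<Rightarrow> nat \<Rightarrow> data \<Rightarrow> nat \<Rightarrow> data \<Rightarrow> bool" where
  "does c N x t y \<longleftrightarrow>
     (\<forall>s. s 0 = x \<longrightarrow> (\<forall>v. 0 < v \<and> v < N \<longrightarrow> s v = Lf) \<longrightarrow> exec c s t (s(0 := y)))"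

lemma doesD:
  "does c N x t y \<Longrightarrow> s 0 = x \<Longrightarrow> (\<And>v. 0 < v \<Longrightarrow> v < N \<Longrightarrow> s v = Lf) \<Longrightarrow> s' = s(0 := y) \<Longrightarrow>
     exec c s t s'"
  unfolding does_def by auto

lemma does_computes: "does c N x t y \<Longrightarrow> computes_in c x t y"
  unfolding does_def computes_in_def by (metis fun_upd_apply less_irrefl)

lemma does_size: "does c N x t y \<Longrightarrow> tsize y \<le> t + tsize x"
  using exec_size[of _ _ _ _ 0] by (fastforce simp: computes_in_def dest!: does_computes)

fun reset :: "nat \<Rightarrow> com" where
  "reset 0 = Skip"
| "reset (Suc n) = Seq (reset n) (Assign (Suc n) Leaf)"

lemma exec_reset: "exec (reset n) s (1 + 2 * n) (\<lambda>v. if 0 < v \<and> v \<le> n then Lf else s v)"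
proof (induction n)
  case 0
  have "(\<lambda>v. if 0 < v \<and> v \<le> 0 then Lf else s v) = s" by auto
  then show ?case using exec.Skip[of s] by simp
next
  case (Suc n)
  let ?s = "\<lambda>v. if 0 < v \<and> v \<le> n then Lf else s v"
  have "exec (Assign (Suc n) Leaf) ?s 2 (?s(Suc n := Lf))"
    using exec.Assign[of "Suc n" Leaf ?s] by (simp add: numeral_2_eq_2)
  then have "exec (reset (Suc n)) s (1 + 2 * n + 2) (?s(Suc n := Lf))"
    unfolding reset.simps using exec.Seq[OF Suc] by blast
  moreover have "?s(Suc n := Lf) = (\<lambda>v. if 0 < v \<and> v \<le> Suc n then Lf else s v)"
    by auto
  ultimately show ?case by (simp add: numeral_eq_Suc)
qed

text \<open>The program of a given fpt-reduction may leave intermediate trees behind. Sweeping its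
  variables afterwards brings it under the calling convention, at a cost independent of the
  input.\<close>

lemma computes_does:
  assumes "computes_in c x t y"
  shows "does (Seq c (reset (com_bound c))) (Suc (com_bound c)) x
    (t + (1 + 2 * com_bound c)) y"
  unfolding does_def
proof (intro allI impI)
  fix s :: state
  assume s: "s 0 = x" "\<forall>v. 0 < v \<and> v < Suc (com_bound c) \<longrightarrow> s v = Lf"
  from assms obtain s' where s': "exec c ((\<lambda>_. Lf)(0 := x)) t s'" "s' 0 = y"
    unfolding computes_in_def by auto
  let ?r = "\<lambda>v. if v < Suc (com_bound c) then s' v else s v"
  have "exec c s t ?r"
    by (rule exec_transfer[OF s'(1)]) (use s in auto)
  moreover have "(\<lambda>v. if 0 < v \<and> v \<le> com_bound c then Lf else ?r v) = s(0 := y)"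
    using s s' by auto
  ultimately show "exec (Seq c (reset (com_bound c))) s (t + (1 + 2 * com_bound c)) (s(0 := y))"
    using exec_reset[of "com_bound c" ?r] exec.Seq by metis
qed

lemma exec_Assign: "y = eval e s \<Longrightarrow> t = 1 + tsize y \<Longrightarrow> s' = s(v := y) \<Longrightarrow> exec (Assign v e) s t s'"
  using exec.Assign[of v e s] by simp

section \<open>Sequencing, pairing, branching and folding under the calling convention\<close>

lemma does_seq:
  assumes "does c M x t y" "does c' N y t' z"
  shows "does (Seq c c') (max M N) x (t + t') z"
  unfolding does_def
proof (intro allI impI)
  fix s :: state
  assume "s 0 = x" "\<forall>v. 0 < v \<and> v < max M N \<longrightarrow> s v = Lf"
  then show "exec (Seq c c') s (t + t') (s(0 := z))"
    by (intro exec.Seq[of c s t "s(0 := y)"] doesD[OF assms(1)] doesD[OF assms(2)]) auto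
qed

text \<open>Variable \<open>w\<close> saves the input for the second program and
  \<open>Suc w\<close> the first result; \<open>w\<close> is later chosen above both workspaces and
  positive, so neither program disturbs them.\<close>

definition pair_com :: "nat \<Rightarrow> com \<Rightarrow> com \<Rightarrow> com" where
  "pair_com w c c' = Seq (Assign w (Var 0)) (Seq c (Seq (Assign (Suc w) (Var 0))
     (Seq (Assign 0 (Var w)) (Seq (Assign w Leaf) (Seq c'
     (Seq (Assign 0 (Pair (Var (Suc w)) (Var 0))) (Assign (Suc w) Leaf)))))))"

lemma does_pair:
  assumes "does c M x t y" "does c' N x t' z"
  defines "w \<equiv> Suc (max M N)"
  shows "does (pair_com w c c') (w + 2) x
    (t + t' + 2 * tsize x + 2 * tsize y + tsize z + 9) (Br y z)"
  unfolding does_def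
proof (intro allI impI)
  fix s :: state
  assume s: "s 0 = x" "\<forall>v. 0 < v \<and> v < w + 2 \<longrightarrow> s v = Lf"
  have "0 < w" by (simp add: w_def)
  then have sw: "s w = Lf" "s (Suc w) = Lf" using s(2) by simp_all
  let ?t = "(1 + tsize x) + (t + ((1 + tsize y) + ((1 + tsize x) + ((1 + 1) + (t' +
    ((1 + (1 + tsize y + tsize z)) + (1 + 1)))))))"
  have "exec (pair_com w c c') s ?t (s(0 := Br y z))"
    unfolding pair_com_def
    apply (rule exec.Seq[OF exec_Assign[OF refl]])
      apply (simp add: s)
     apply (rule refl)
    apply (rule exec.Seq[OF doesD[OF assms(1)]])
       apply (use s in \<open>auto simp: w_def\<close>)[2]
     apply (rule refl)
    apply (rule exec.Seq[OF exec_Assign[OF refl]])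
      apply (simp add: w_def)
     apply (rule refl)
    apply (rule exec.Seq[OF exec_Assign[OF refl]])
      apply (use s in \<open>simp add: w_def\<close>)
     apply (rule refl)
    apply (rule exec.Seq[OF exec_Assign[OF refl]])
      apply (simp add: w_def)
     apply (rule refl)
    apply (rule exec.Seq[OF doesD[OF assms(2)]])
       apply (use s in \<open>auto simp: w_def\<close>)[2]
     apply (rule refl)
    apply (rule exec.Seq[OF exec_Assign[OF refl]])
      apply (simp add: w_def)
     apply (rule refl)
    apply (rule exec_Assign[OF refl])
     apply simp
    apply (use s sw in \<open>auto simp: w_def fun_eq_iff\<close>)
    done
  moreover have "?t = t + t' + 2 * tsize x + 2 * tsize y + tsize z + 9" by simp
  ultimately show "exec (pair_com w c c') s (t + t' + 2 * tsize x + 2 * tsize y + tsize z + 9) (s(0 := Br y z))"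
    by metis
qed

text \<open>The test value is moved to \<open>w\<close>, which must be empty again at the end. In
  the false branch it already is; clearing it in the true branch costs two more time units.\<close>

definition cond_com :: "nat \<Rightarrow> com \<Rightarrow> com \<Rightarrow> com" where
  "cond_com w c c' = Seq (Assign w (Left (Var 0))) (Seq (Assign 0 (Right (Var 0)))
     (Cond w (Seq (Assign w Leaf) c) c'))"

lemma does_cond:
  assumes "b \<noteq> Lf \<Longrightarrow> does c M x t y" "b = Lf \<Longrightarrow> does c' N x t y"
  defines "w \<equiv> Suc (max M N)"
  shows "does (cond_com w c c') (Suc w) (Br b x)
    (t + tsize b + tsize x + (if b = Lf then 3 else 5)) y"
  unfolding does_def
proof (intro allI impI)
  fix s :: state
  assume s: "s 0 = Br b x" "\<forall>v. 0 < v \<and> v < Suc w \<longrightarrow> s v = Lf"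
  let ?s = "(s(w := b))(0 := x)"
  have *: "exec (Cond w (Seq (Assign w Leaf) c) c') ?s
     (if b = Lf then 1 + t else 1 + (2 + t)) (s(0 := y))"
  proof (cases "b = Lf")
    case True
    have "exec (Cond w (Seq (Assign w Leaf) c) c') ?s (1 + t) (s(0 := y))"
      apply (rule exec.CondFalse)
       apply (simp add: True w_def)
      apply (rule doesD[OF assms(2)])
      using s True by (auto simp: w_def)
    then show ?thesis using True by simp
  next
    case False
    have "exec (Cond w (Seq (Assign w Leaf) c) c') ?s (1 + (2 + t)) (s(0 := y))"
      apply (rule exec.CondTrue)
       apply (simp add: False w_def)
      apply (rule exec.Seq)
       apply (rule exec_Assign[OF refl])
        apply simp
       apply (rule refl)
      apply (rule doesD[OF assms(1)])
      using s False by (auto simp: w_def)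
    then show ?thesis using False by simp
  qed
  let ?t = "(1 + tsize b) + ((1 + tsize x) + (if b = Lf then 1 + t else 1 + (2 + t)))"
  have "exec (cond_com w c c') s ?t (s(0 := y))"
    unfolding cond_com_def
    apply (rule exec.Seq[OF exec_Assign[OF refl]])
      apply (simp add: s)
     apply (rule refl)
    apply (rule exec.Seq[OF exec_Assign[OF refl]])
      apply (simp add: s w_def)
     apply (rule refl)
    using * by (simp add: s w_def)
  moreover have "?t = t + tsize b + tsize x + (if b = Lf then 3 else 5)" by simp
  ultimately show "exec (cond_com w c c') s (t + tsize b + tsize x + (if b = Lf then 3 else 5)) (s(0 := y))"
    by metis
qed

definition fold_loop :: "nat \<Rightarrow> com \<Rightarrow> com" where
  "fold_loop w c = While (Suc w) (Seq (Assign 0 (Pair (Pair (Var w) (Left (Var (Suc w)))) (Var 0)))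
     (Seq c (Assign (Suc w) (Right (Var (Suc w))))))"

definition fold_com :: "nat \<Rightarrow> com \<Rightarrow> com" where
  "fold_com w c = Seq (Assign w (Left (Left (Var 0)))) (Seq (Assign (Suc w) (Right (Left (Var 0))))
     (Seq (Assign 0 (Right (Var 0))) (Seq (fold_loop w c) (Assign w Leaf))))"

text \<open>The bounds are demanded only along the actual run of the fold. A step that is polynomial
  on its own may still square the size of its accumulator each time, so its cost on arbitrary
  accumulators has no useful bound.\<close>

lemma exec_fold_loop:
  assumes step: "\<And>l x l'. xs = l @ x # l' \<Longrightarrow> \<exists>t \<le> T.
      does c N (Br (Br e (ex x)) (ea (fold F l a))) t (ea (F x (fold F l a)))"
    and size: "\<And>l l'. xs = l @ l' \<Longrightarrow> tsize (ea (fold F l a)) \<le> B"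
    and w: "N \<le> w" "0 < w"
    and len: "length xs \<le> n" and K: "tsize e + tsize (enc_list ex xs) \<le> K"
  shows "\<exists>t \<le> 1 + n * (2 * K + B + T + 6). \<forall>s. s 0 = ea a \<longrightarrow> s w = e \<longrightarrow>
     s (Suc w) = enc_list ex xs \<longrightarrow> (\<forall>v. 0 < v \<and> v < w \<longrightarrow> s v = Lf) \<longrightarrow>
     exec (fold_loop w c) s t (s(0 := ea (fold F xs a), Suc w := Lf))"
  using assms
proof (induction xs arbitrary: a n)
  case Nil
  have "exec (fold_loop w c) s 1 (s(0 := ea a, Suc w := Lf))" if "s 0 = ea a" "s (Suc w) = Lf" for s
  proof -
    have "s(0 := ea a, Suc w := Lf) = s" using that by auto
    then show ?thesis
      unfolding fold_loop_def using that exec.WhileFalse[of s "Suc w"] by auto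
  qed
  then show ?case by (intro exI[of _ 1]) (auto simp del: fun_upd_apply)
next
  case (Cons x xs)
  obtain m where m: "n = Suc m" "length xs \<le> m" using Cons.prems(5) by (cases n) auto
  obtain t1 where t1: "t1 \<le> T" "does c N (Br (Br e (ex x)) (ea a)) t1 (ea (F x a))"
    using Cons.prems(1)[of "[]" x xs] by auto
  have sa: "tsize (ea a) \<le> B" using Cons.prems(2)[of "[]"] by auto
  let ?a = "F x a"
  have "\<exists>t \<le> 1 + m * (2 * K + B + T + 6). \<forall>s. s 0 = ea ?a \<longrightarrow> s w = e \<longrightarrow>
     s (Suc w) = enc_list ex xs \<longrightarrow> (\<forall>v. 0 < v \<and> v < w \<longrightarrow> s v = Lf) \<longrightarrow>
     exec (fold_loop w c) s t (s(0 := ea (fold F xs ?a), Suc w := Lf))"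
  proof (rule Cons.IH)
    fix l y l' assume "xs = l @ y # l'"
    then show "\<exists>t\<le>T. does c N (Br (Br e (ex y)) (ea (fold F l ?a))) t (ea (F y (fold F l ?a)))"
      using Cons.prems(1)[of "x # l" y l'] by auto
  next
    fix l l' assume "xs = l @ l'"
    then show "tsize (ea (fold F l ?a)) \<le> B"
      using Cons.prems(2)[of "x # l" l'] by auto
  qed (use Cons.prems m in auto)
  then obtain t2 where t2: "t2 \<le> 1 + m * (2 * K + B + T + 6)"
    "\<And>s. s 0 = ea ?a \<Longrightarrow> s w = e \<Longrightarrow>
     s (Suc w) = enc_list ex xs \<Longrightarrow> (\<forall>v. 0 < v \<and> v < w \<longrightarrow> s v = Lf) \<Longrightarrow>
     exec (fold_loop w c) s t2 (s(0 := ea (fold F xs ?a), Suc w := Lf))"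
    by blast
  let ?t = "(1 + (1 + (1 + tsize e + tsize (ex x)) + tsize (ea a))) + (t1 + (1 + tsize (enc_list ex xs)))"
  have "exec (fold_loop w c) s (1 + ?t + t2) (s(0 := ea (fold F (x # xs) a), Suc w := Lf))"
    if s: "s 0 = ea a" "s w = e" "s (Suc w) = enc_list ex (x # xs)" "\<forall>v. 0 < v \<and> v < w \<longrightarrow> s v = Lf" for s
  proof -
    let ?s = "s(0 := ea ?a, Suc w := enc_list ex xs)"
    have body: "exec (Seq (Assign 0 (Pair (Pair (Var w) (Left (Var (Suc w)))) (Var 0)))
       (Seq c (Assign (Suc w) (Right (Var (Suc w)))))) s ?t ?s"
      apply (rule exec.Seq[OF exec_Assign[OF refl]])
        apply (use s in simp)
       apply (rule refl)
      apply (rule exec.Seq[OF doesD[OF t1(2)]])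
         apply (use s Cons.prems in auto)[2]
       apply (rule refl)
      apply (rule exec_Assign[OF refl])
       apply (use s Cons.prems in auto)
      done
    have "exec (fold_loop w c) ?s t2 (?s(0 := ea (fold F xs ?a), Suc w := Lf))"
      by (rule t2(2)) (use s w in auto)
    moreover have "?s(0 := ea (fold F xs ?a), Suc w := Lf) = s(0 := ea (fold F (x # xs) a), Suc w := Lf)"
      by auto
    moreover have "s (Suc w) \<noteq> Lf" using s by simp
    ultimately show ?thesis
      using exec.WhileTrue[of s "Suc w", OF _ body] unfolding fold_loop_def by simp
  qed
  moreover have "1 + ?t + t2 \<le> 1 + n * (2 * K + B + T + 6)"
    using t1(1) t2(1) sa Cons.prems(6) m by auto
  ultimately show ?case by blast
qed

lemma does_fold:
  assumes step: "\<And>l x l'. xs = l @ x # l' \<Longrightarrow> \<exists>t \<le> T.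
      does c N (Br (Br e (ex x)) (ea (fold F l a))) t (ea (F x (fold F l a)))"
    and size: "\<And>l l'. xs = l @ l' \<Longrightarrow> tsize (ea (fold F l a)) \<le> B"
  defines "w \<equiv> Suc N" and "K \<equiv> tsize e + tsize (enc_list ex xs)"
  shows "\<exists>t \<le> 6 + K + B + length xs * (2 * K + B + T + 6).
    does (fold_com w c) (w + 2) (Br (Br e (enc_list ex xs)) (ea a)) t (ea (fold F xs a))"
proof -
  have "\<exists>t \<le> 1 + length xs * (2 * K + B + T + 6). \<forall>s. s 0 = ea a \<longrightarrow> s w = e \<longrightarrow>
     s (Suc w) = enc_list ex xs \<longrightarrow> (\<forall>v. 0 < v \<and> v < w \<longrightarrow> s v = Lf) \<longrightarrow>
     exec (fold_loop w c) s t (s(0 := ea (fold F xs a), Suc w := Lf))"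
    by (rule exec_fold_loop[where N = N]) (fact step size | simp add: w_def K_def)+
  then obtain t where t: "t \<le> 1 + length xs * (2 * K + B + T + 6)"
    "\<And>s. s 0 = ea a \<Longrightarrow> s w = e \<Longrightarrow> s (Suc w) = enc_list ex xs \<Longrightarrow>
     (\<forall>v. 0 < v \<and> v < w \<longrightarrow> s v = Lf) \<Longrightarrow>
     exec (fold_loop w c) s t (s(0 := ea (fold F xs a), Suc w := Lf))"
    by auto
  let ?t = "(1 + tsize e) + ((1 + tsize (enc_list ex xs)) + ((1 + tsize (ea a)) + (t + (1 + 1))))"
  have "exec (fold_com w c) s ?t (s(0 := ea (fold F xs a)))"
    if s: "s 0 = Br (Br e (enc_list ex xs)) (ea a)" "\<forall>v. 0 < v \<and> v < w + 2 \<longrightarrow> s v = Lf" for s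
    unfolding fold_com_def
    apply (rule exec.Seq[OF exec_Assign[OF refl]])
      apply (simp add: s)
     apply (rule refl)
    apply (rule exec.Seq[OF exec_Assign[OF refl]])
      apply (simp add: s w_def)
     apply (rule refl)
    apply (rule exec.Seq[OF exec_Assign[OF refl]])
      apply (simp add: s w_def)
     apply (rule refl)
    apply (rule exec.Seq[OF t(2)])
        apply (use s in \<open>auto simp: w_def\<close>)[4]
    apply (rule exec_Assign[OF refl])
     apply simp
    apply (use s in \<open>auto simp: w_def\<close>)
    done
  then have "does (fold_com w c) (w + 2) (Br (Br e (enc_list ex xs)) (ea a)) ?t (ea (fold F xs a))"
    unfolding does_def by blast
  moreover have "?t \<le> 6 + K + B + length xs * (2 * K + B + T + 6)"
    using t(1) size[of "[]"] by (auto simp: K_def)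
  ultimately show ?thesis by blast
qed

section \<open>Polynomial-time functions on encoded types\<close>

class enc =
  fixes enc :: "'a \<Rightarrow> data"

instantiation data :: enc
begin
definition "enc (x :: data) = x"
instance ..
end

instantiation unit :: enc
begin
definition "enc (x :: unit) = Lf"
instance ..
end

instantiation bool :: enc
begin
definition "enc b = (if b then Br Lf Lf else Lf)"
instance ..
end

instantiation nat :: enc
begin
definition "enc n = enc_nat n"
instance ..
end

instantiation prod :: (enc, enc) enc
begin
definition "enc p = Br (enc (fst p)) (enc (snd p))"
instance ..
end

instantiation list :: (enc) enc
begin
definition "enc xs = enc_list enc xs"
instance ..
end

instantiation gate :: enc
begin
definition "enc g = enc_gate g"
instance ..
end

section \<open>Sizes of encodings and polynomial bounds\<close>

lemma enc_Pair [simp]: "enc (x, y) = Br (enc x) (enc y)"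
  by (simp add: enc_prod_def)

lemma enc_Nil [simp]: "enc [] = Lf"
  and enc_Cons [simp]: "enc (x # xs) = Br (enc x) (enc xs)"
  by (simp_all add: enc_list_def)

lemma tsize_pos [simp]: "0 < tsize x"
  by (cases x) auto

lemma tsize_enc_list: "tsize (enc xs) = 1 + (\<Sum>x\<leftarrow>xs. 1 + tsize (enc x))"
  by (induction xs) auto

lemma tsize_enc_append: "tsize (enc (xs @ ys)) + 1 = tsize (enc xs) + tsize (enc ys)"
  by (simp add: tsize_enc_list)

lemma tsize_append_le1: "tsize (enc xs) \<le> tsize (enc (xs @ ys))"
  and tsize_append_le2: "tsize (enc ys) \<le> tsize (enc (xs @ ys))"
  by (simp_all add: tsize_enc_list)

lemma tsize_enc_rev [simp]: "tsize (enc (rev xs)) = tsize (enc xs)"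
  by (simp add: tsize_enc_list rev_map[symmetric])

lemma length_less_tsize: "length xs < tsize (enc xs)"
  by (induction xs) auto

lemma tsize_elem: "x \<in> set xs \<Longrightarrow> tsize (enc x) < tsize (enc xs)"
  by (induction xs) auto

lemma tsize_enc_le:
  assumes "\<And>x. x \<in> set xs \<Longrightarrow> tsize (enc x) \<le> M"
  shows "tsize (enc xs) \<le> 1 + length xs * (1 + M)"
  using assms by (induction xs) fastforce+

lemma tsize_enc_nat [simp]: "tsize (enc (n :: nat)) = 2 * n + 1"
  unfolding enc_nat_def by (induction n) auto

lemma tsize_enc_bool: "tsize (enc (b :: bool)) \<le> 3"
  by (simp add: enc_bool_def)

text \<open>The base is at least 3, so constants and sums are absorbed by a larger exponent, and one
  exponent can stand for a polynomial.\<close>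

definition polyb :: "('a :: enc \<Rightarrow> nat) \<Rightarrow> bool" where
  "polyb T \<longleftrightarrow> (\<exists>e. \<forall>x. T x \<le> (tsize (enc x) + 2) ^ e)"

lemma polyb_mono: "polyb T \<Longrightarrow> (\<And>x. S x \<le> T x) \<Longrightarrow> polyb S"
  unfolding polyb_def using le_trans by blast

lemma polyb_const: "polyb (\<lambda>x. c)"
proof -
  have "c \<le> (tsize (enc x) + 2) ^ c" for x :: 'a
    by (metis less_exp less_imp_le le_trans power_mono le_add2 zero_le)
  then show ?thesis unfolding polyb_def by blast
qed

lemma polyb_tsize: "polyb (\<lambda>x. tsize (enc x))"
  unfolding polyb_def by (intro exI[of _ 1]) simp

lemma polyb_mult:
  assumes "polyb S" "polyb T" shows "polyb (\<lambda>x. S x * T x)"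
proof -
  obtain a b where "\<And>x. S x \<le> (tsize (enc x) + 2) ^ a" "\<And>x. T x \<le> (tsize (enc x) + 2) ^ b"
    using assms unfolding polyb_def by blast
  then have "S x * T x \<le> (tsize (enc x) + 2) ^ (a + b)" for x
    unfolding power_add by (rule mult_le_mono)
  then show ?thesis unfolding polyb_def by blast
qed

lemma polyb_add:
  assumes "polyb S" "polyb T" shows "polyb (\<lambda>x. S x + T x)"
proof -
  obtain a b where ab: "\<And>x. S x \<le> (tsize (enc x) + 2) ^ a" "\<And>x. T x \<le> (tsize (enc x) + 2) ^ b"
    using assms unfolding polyb_def by blast
  have "S x + T x \<le> (tsize (enc x) + 2) ^ (1 + (a + b))" for x
  proof -
    let ?n = "tsize (enc x) + 2"
    have "?n ^ a \<le> ?n ^ (a + b)" "?n ^ b \<le> ?n ^ (a + b)"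
      by (rule power_increasing; simp)+
    then have "S x + T x \<le> 2 * ?n ^ (a + b)" using ab[of x] by linarith
    also have "\<dots> \<le> ?n * ?n ^ (a + b)" by (rule mult_le_mono) auto
    finally show ?thesis by simp
  qed
  then show ?thesis unfolding polyb_def by blast
qed

lemma polyb_pow: "polyb S \<Longrightarrow> polyb (\<lambda>x. S x ^ n)"
  by (induction n) (auto intro: polyb_const polyb_mult)

lemma polyb_comp:
  assumes "polyb T" "polyb (\<lambda>x. tsize (enc (f x)))"
  shows "polyb (\<lambda>x. T (f x))"
proof -
  obtain a where a: "\<And>x. T x \<le> (tsize (enc x) + 2) ^ a"
    using assms unfolding polyb_def by blast
  have "polyb (\<lambda>x. (tsize (enc (f x)) + 2) ^ a)"
    by (intro polyb_pow polyb_add polyb_const assms)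
  then show ?thesis using a by (rule polyb_mono)
qed

lemmas polyb_intros = polyb_const polyb_tsize polyb_mult polyb_add polyb_pow

definition ptime :: "('a :: enc \<Rightarrow> 'b :: enc) \<Rightarrow> bool" where
  "ptime f \<longleftrightarrow> (\<exists>c N T. polyb T \<and> (\<forall>x. \<exists>t \<le> T x. does c N (enc x) t (enc (f x))))"

lemma ptime_polyb:
  assumes "ptime f" shows "polyb (\<lambda>x. tsize (enc (f x)))"
proof -
  obtain c N T where T: "polyb T" "\<And>x. \<exists>t \<le> T x. does c N (enc x) t (enc (f x))"
    using assms unfolding ptime_def by blast
  have "polyb (\<lambda>x. T x + tsize (enc x))" by (intro polyb_intros T)
  moreover have "tsize (enc (f x)) \<le> T x + tsize (enc x)" for x
    using T(2)[of x] does_size by fastforce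
  ultimately show ?thesis by (rule polyb_mono)
qed

fun expr_size :: "expr \<Rightarrow> nat" where
  "expr_size (Pair e e') = 1 + expr_size e + expr_size e'"
| "expr_size (Left e) = expr_size e"
| "expr_size (Right e) = expr_size e"
| "expr_size e = 1"

lemma tsize_left: "tsize (left x) \<le> tsize x" and tsize_right: "tsize (right x) \<le> tsize x"
  by (cases x; simp)+

lemma tsize_eval: "tsize (eval e (\<lambda>_. x)) \<le> expr_size e * tsize x"
proof (induction e)
  case (Pair e e')
  then show ?case
    using tsize_pos[of x] unfolding expr_size.simps eval.simps tsize.simps distrib_right by linarith
qed (auto simp: Suc_le_eq intro: le_trans[OF tsize_left] le_trans[OF tsize_right])

lemma ptime_expr:
  assumes "\<And>x s. s 0 = enc x \<Longrightarrow> eval e s = enc (f x)"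
  shows "ptime f"
  unfolding ptime_def
proof (intro exI conjI allI)
  show "polyb (\<lambda>x. 1 + expr_size e * tsize (enc x))" by (intro polyb_intros)
  fix x
  have "enc (f x) = eval e (\<lambda>_. enc x)" using assms[of "\<lambda>_. enc x" x] by simp
  then show "1 + tsize (enc (f x)) \<le> 1 + expr_size e * tsize (enc x)"
    using tsize_eval by simp
  show "does (Assign 0 e) 1 (enc x) (1 + tsize (enc (f x))) (enc (f x))"
    unfolding does_def using exec.Assign[of 0 e] assms by metis
qed

lemma ptime_comp:
  assumes "ptime g" "ptime f" shows "ptime (\<lambda>x. g (f x))"
proof -
  obtain c N T where T: "polyb T" "\<And>x. \<exists>t \<le> T x. does c N (enc x) t (enc (f x))"
    using assms unfolding ptime_def by blast
  obtain c' N' T' where T': "polyb T'" "\<And>x. \<exists>t \<le> T' x. does c' N' (enc x) t (enc (g x))"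
    using assms unfolding ptime_def by blast
  have "polyb (\<lambda>x. T x + T' (f x))"
    by (intro polyb_intros T polyb_comp[OF T'(1)] ptime_polyb assms)
  moreover have "\<exists>t \<le> T x + T' (f x). does (Seq c c') (max N N') (enc x) t (enc (g (f x)))" for x
    using T(2)[of x] T'(2)[of "f x"] does_seq add_mono by blast
  ultimately show ?thesis unfolding ptime_def by blast
qed

lemma ptime_Pair:
  assumes "ptime f" "ptime g" shows "ptime (\<lambda>x. (f x, g x))"
proof -
  obtain c N T where T: "polyb T" "\<And>x. \<exists>t \<le> T x. does c N (enc x) t (enc (f x))"
    using assms unfolding ptime_def by blast
  obtain c' N' T' where T': "polyb T'" "\<And>x. \<exists>t \<le> T' x. does c' N' (enc x) t (enc (g x))"
    using assms unfolding ptime_def by blast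
  let ?T = "\<lambda>x. T x + T' x + 2 * tsize (enc x) + 2 * tsize (enc (f x)) + tsize (enc (g x)) + 9"
  have "polyb ?T"
    by (intro polyb_intros T T' ptime_polyb assms)
  moreover have "\<exists>t \<le> ?T x. does (pair_com (Suc (max N N')) c c') (Suc (max N N') + 2) (enc x) t (enc (f x, g x))" for x
  proof -
    obtain t t' where t: "t \<le> T x" "does c N (enc x) t (enc (f x))"
      "t' \<le> T' x" "does c' N' (enc x) t' (enc (g x))"
      using T(2) T'(2) by meson
    have "t + t' + 2 * tsize (enc x) + 2 * tsize (enc (f x)) + tsize (enc (g x)) + 9 \<le> ?T x"
      using t(1,3) by linarith
    with does_pair[OF t(2,4)] show ?thesis
      unfolding enc_Pair by blast
  qed
  ultimately show ?thesis unfolding ptime_def by blast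
qed

lemma ptime_If:
  assumes "ptime b" "ptime f" "ptime g" shows "ptime (\<lambda>x. if b x then f x else g x)"
proof -
  obtain c N T where T: "polyb T" "\<And>x. \<exists>t \<le> T x. does c N (enc x) t (enc (f x))"
    using assms unfolding ptime_def by blast
  obtain c' N' T' where T': "polyb T'" "\<And>x. \<exists>t \<le> T' x. does c' N' (enc x) t (enc (g x))"
    using assms unfolding ptime_def by blast
  have "ptime (\<lambda>x. x)"
    by (rule ptime_expr[of "Var 0"]) simp
  then have "ptime (\<lambda>x. (b x, x))"
    by (rule ptime_Pair[OF assms(1)])
  then obtain d M U where U: "polyb U" "\<And>x. \<exists>t \<le> U x. does d M (enc x) t (enc (b x, x))"
    unfolding ptime_def by blast
  let ?w = "Suc (max N N')"
  let ?T = "\<lambda>x. U x + ((T x + T' x) + 3 + tsize (enc x) + 5)"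
  have "polyb ?T"
    by (intro polyb_intros T T' U)
  moreover have "\<exists>t \<le> ?T x. does (Seq d (cond_com ?w c c')) (max M (Suc ?w)) (enc x) t (enc (if b x then f x else g x))" for x
  proof -
    obtain u t t' where u: "u \<le> U x" "does d M (enc x) u (enc (b x, x))"
      and t: "t \<le> T x" "does c N (enc x) t (enc (f x))"
      and t': "t' \<le> T' x" "does c' N' (enc x) t' (enc (g x))"
      using T(2) T'(2) U(2) by meson
    let ?v = "(if b x then t else t') + tsize (enc (b x)) + tsize (enc x) + (if enc (b x) = Lf then 3 else 5)"
    have "does (cond_com ?w c c') (Suc ?w) (Br (enc (b x)) (enc x)) ?v (enc (if b x then f x else g x))"
      by (rule does_cond) (use t t' in \<open>auto simp: enc_bool_def split: if_splits\<close>)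
    moreover have "?v \<le> (T x + T' x) + 3 + tsize (enc x) + 5"
      using t(1) t'(1) tsize_enc_bool[of "b x"] by auto
    ultimately show ?thesis
      using u does_seq add_mono by (metis enc_Pair)
  qed
  ultimately show ?thesis unfolding ptime_def by blast
qed

text \<open>Bounded recursion in the style of Cobham: a polynomial-time step may be iterated over a
  list as long as \<open>B\<close> certifies that the intermediate results stay small. The list
  functions below, and through them arithmetic, rest on this.\<close>

lemma ptime_fold:
  fixes h :: "'e :: enc \<Rightarrow> 'x :: enc \<Rightarrow> 'a :: enc \<Rightarrow> 'a"
  assumes h: "ptime (\<lambda>z. h (fst (fst z)) (snd (fst z)) (snd z))"
    and L: "ptime L" and A: "ptime A" and B: "polyb B"
    and size: "\<And>x l l'. L x = l @ l' \<Longrightarrow> tsize (enc (fold (h x) l (A x))) \<le> B x"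
  shows "ptime (\<lambda>x. fold (h x) (L x) (A x))"
proof -
  have "ptime (\<lambda>x. x)"
    by (rule ptime_expr[of "Var 0"]) simp
  then have "ptime (\<lambda>x. ((x, L x), A x))"
    by (intro ptime_Pair L A)
  then obtain d M U where U: "polyb U" "\<And>x. \<exists>t \<le> U x. does d M (enc x) t (enc ((x, L x), A x))"
    unfolding ptime_def by blast
  obtain c N S where S: "polyb S"
      "\<And>z. \<exists>t \<le> S z. does c N (enc z) t (enc (h (fst (fst z)) (snd (fst z)) (snd z)))"
    using h unfolding ptime_def by blast
  obtain k where k: "\<And>z. S z \<le> (tsize (enc z) + 2) ^ k"
    using S(1) unfolding polyb_def by blast
  define K where "K x = tsize (enc x) + tsize (enc (L x))" for x
  \<comment> \<open>A step is run on \<open>((x, y), a)\<close>: its two pair nodes and the 2 from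
    \<open>polyb\<close> make up the 4.\<close>
  define T where "T x = (K x + B x + 4) ^ k" for x
  let ?R = "\<lambda>x. 6 + K x + B x + tsize (enc (L x)) * (2 * K x + B x + T x + 6)"
  have "polyb (\<lambda>x. U x + ?R x)"
    unfolding T_def K_def by (intro polyb_intros U B ptime_polyb L)
  moreover have "\<exists>t \<le> U x + ?R x.
    does (Seq d (fold_com (Suc N) c)) (max M (Suc N + 2)) (enc x) t (enc (fold (h x) (L x) (A x)))" for x
  proof -
    obtain u where u: "u \<le> U x" "does d M (enc x) u (enc ((x, L x), A x))"
      using U(2) by blast
    have "\<exists>t \<le> 6 + (tsize (enc x) + tsize (enc_list enc (L x))) + B x +
        length (L x) * (2 * (tsize (enc x) + tsize (enc_list enc (L x))) + B x + T x + 6).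
      does (fold_com (Suc N) c) (Suc N + 2) (Br (Br (enc x) (enc_list enc (L x))) (enc (A x))) t
        (enc (fold (h x) (L x) (A x)))"
    proof (rule does_fold)
      fix l y l' assume l: "L x = l @ y # l'"
      let ?a = "fold (h x) l (A x)"
      have "tsize (enc y) < tsize (enc (L x))" using l by (intro tsize_elem) auto
      moreover have "tsize (enc ?a) \<le> B x" by (rule size[OF l])
      ultimately have "tsize (enc ((x, y), ?a)) + 2 \<le> K x + B x + 4"
        by (simp add: K_def)
      then have "(tsize (enc ((x, y), ?a)) + 2) ^ k \<le> T x"
        unfolding T_def by (rule power_mono) simp
      then have "S ((x, y), ?a) \<le> T x" using k le_trans by blast
      then show "\<exists>t \<le> T x. does c N (Br (Br (enc x) (enc y)) (enc ?a)) t (enc (h x y ?a))"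
        using S(2)[of "((x, y), ?a)"] le_trans by fastforce
    qed (rule size)
    then obtain t where t: "t \<le> 6 + K x + B x + length (L x) * (2 * K x + B x + T x + 6)"
      "does (fold_com (Suc N) c) (Suc N + 2) (enc ((x, L x), A x)) t (enc (fold (h x) (L x) (A x)))"
      unfolding enc_list_def[symmetric] K_def[symmetric] enc_Pair by blast
    have "t \<le> ?R x"
      using t(1) mult_le_mono1[OF less_imp_le[OF length_less_tsize[of "L x"]], of "2 * K x + B x + T x + 6"]
      by linarith
    with u(1) have "u + t \<le> U x + ?R x" by (rule add_mono)
    with does_seq[OF u(2) t(2)] show ?thesis by blast
  qed
  ultimately show ?thesis unfolding ptime_def by blast
qed

subsection \<open>Pairs, constants and booleans\<close>

lemma ptime_id: "ptime (\<lambda>x. x)"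
  by (rule ptime_expr[of "Var 0"]) simp

fun const_expr :: "data \<Rightarrow> expr" where
  "const_expr Lf = Leaf"
| "const_expr (Br x y) = Pair (const_expr x) (const_expr y)"

lemma eval_const_expr: "eval (const_expr x) s = x"
  by (induction x) auto

lemma ptime_const: "ptime (\<lambda>x. c)"
  by (rule ptime_expr[of "const_expr (enc c)"]) (rule eval_const_expr)

lemma ptime_cong: "ptime f \<Longrightarrow> (\<And>x. f x = g x) \<Longrightarrow> ptime g"
  by (drule ext) simp

lemma ptime_expr_comp:
  assumes "ptime f" "\<And>x s. s 0 = enc x \<Longrightarrow> eval e s = enc (g x)"
  shows "ptime (\<lambda>x. g (f x))"
  by (rule ptime_comp[OF ptime_expr[of e g] assms(1)]) (use assms in auto)

lemma ptime_fst: "ptime f \<Longrightarrow> ptime (\<lambda>x. fst (f x))"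
  by (rule ptime_expr_comp[of _ "Left (Var 0)"]) (auto simp: enc_prod_def)

lemma ptime_snd: "ptime f \<Longrightarrow> ptime (\<lambda>x. snd (f x))"
  by (rule ptime_expr_comp[of _ "Right (Var 0)"]) (auto simp: enc_prod_def)

lemma ptime_not: "ptime f \<Longrightarrow> ptime (\<lambda>x. \<not> f x)"
  by (rule ptime_cong[OF ptime_If[of f "\<lambda>_. False" "\<lambda>_. True"]]) (auto intro: ptime_const)

lemma ptime_conj: "ptime f \<Longrightarrow> ptime g \<Longrightarrow> ptime (\<lambda>x. f x \<and> g x)"
  by (rule ptime_cong[OF ptime_If[of f g "\<lambda>_. False"]]) (auto intro: ptime_const)

lemma ptime_disj: "ptime f \<Longrightarrow> ptime g \<Longrightarrow> ptime (\<lambda>x. f x \<or> g x)"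
  by (rule ptime_cong[OF ptime_If[of f "\<lambda>_. True" g]]) (auto intro: ptime_const)

lemma ptime_imp: "ptime f \<Longrightarrow> ptime g \<Longrightarrow> ptime (\<lambda>x. f x \<longrightarrow> g x)"
  by (rule ptime_cong[OF ptime_If[of f g "\<lambda>_. True"]]) (auto intro: ptime_const)

lemma ptime_iff: "ptime f \<Longrightarrow> ptime g \<Longrightarrow> ptime (\<lambda>x. f x = (g x :: bool))"
  by (rule ptime_cong[OF ptime_If[of f g "\<lambda>x. \<not> g x"]]) (auto intro: ptime_not)

lemma ptime_app2:
  assumes "ptime (\<lambda>z. F (fst z) (snd z))" "ptime A" "ptime B"
  shows "ptime (\<lambda>x. F (A x) (B x))"
  using ptime_comp[OF assms(1) ptime_Pair[OF assms(2,3)]] by simp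

subsection \<open>Lists\<close>

lemma ptime_Cons: "ptime f \<Longrightarrow> ptime g \<Longrightarrow> ptime (\<lambda>x. f x # g x)"
  by (rule ptime_app2[of "(#)"], rule ptime_expr[of "Var 0"]) (auto simp: enc_prod_def)

lemma ptime_tl:
  fixes f :: "'a :: enc \<Rightarrow> 'b :: enc list"
  shows "ptime f \<Longrightarrow> ptime (\<lambda>x. tl (f x))"
proof (rule ptime_expr_comp[of f "Right (Var 0)" tl])
  show "eval (Right (Var 0)) s = enc (tl xs)" if "s 0 = enc xs" for xs :: "'b list" and s
    using that by (cases xs) auto
qed

lemma ptime_rev:
  assumes "ptime f" shows "ptime (\<lambda>x. rev (f x))"
proof -
  have "ptime (\<lambda>x. fold (\<lambda>y ys. y # ys) (f x) [])"
  proof (rule ptime_fold)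
    show "tsize (enc (fold (\<lambda>y ys. y # ys) l [])) \<le> tsize (enc (f x))" if "f x = l @ l'" for x l l'
      using tsize_append_le1[of l l'] by (simp add: that flip: rev_conv_fold)
  qed (intro ptime_Cons ptime_fst ptime_snd ptime_id ptime_const assms ptime_polyb)+
  then show ?thesis by (simp flip: rev_conv_fold)
qed

lemma fold_Cons_append: "fold (\<lambda>y ys. y # ys) xs zs = rev xs @ zs"
  by (induction xs arbitrary: zs) auto

lemma ptime_append:
  assumes "ptime f" "ptime g" shows "ptime (\<lambda>x. f x @ g x)"
proof -
  have "ptime (\<lambda>x. fold (\<lambda>y ys. y # ys) (rev (f x)) (g x))"
  proof (rule ptime_fold)
    show "polyb (\<lambda>x. tsize (enc (f x)) + tsize (enc (g x)))"
      by (intro polyb_intros ptime_polyb assms)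
    show "tsize (enc (fold (\<lambda>y ys. y # ys) l (g x))) \<le> tsize (enc (f x)) + tsize (enc (g x))"
      if "rev (f x) = l @ l'" for x l l'
    proof -
      have "f x = rev l' @ rev l" using arg_cong[OF that, of rev] by simp
      then show ?thesis
        using tsize_append_le2[of "rev l" "rev l'"] tsize_enc_append[of "rev l" "g x"]
        unfolding fold_Cons_append by simp
    qed
  qed (intro ptime_Cons ptime_fst ptime_snd ptime_id ptime_rev assms)+
  then show ?thesis by (simp add: fold_Cons_append)
qed

lemma tsize_enc_filter: "tsize (enc (filter P xs)) \<le> tsize (enc xs)"
  by (induction xs) auto

lemma fold_filter: "fold (\<lambda>y ys. if P y then y # ys else ys) xs zs = rev (filter P xs) @ zs"
  by (induction xs arbitrary: zs) auto

lemma ptime_filter: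
  assumes "ptime (\<lambda>z. P (fst z) (snd z))" "ptime f"
  shows "ptime (\<lambda>x. filter (P x) (f x))"
proof -
  have P: "ptime (\<lambda>z. P (fst (fst z)) (snd (fst z)))"
    by (rule ptime_comp[OF assms(1)]) (intro ptime_fst ptime_id)
  have "ptime (\<lambda>x. fold (\<lambda>y ys. if P x y then y # ys else ys) (f x) [])"
  proof (rule ptime_fold)
    show "tsize (enc (fold (\<lambda>y ys. if P x y then y # ys else ys) l [])) \<le> tsize (enc (f x))"
      if "f x = l @ l'" for x l l'
      using tsize_append_le1[of l l'] tsize_enc_filter[of "P x" l]
      unfolding fold_filter that by simp
  qed (intro ptime_If P ptime_Cons ptime_fst ptime_snd ptime_id ptime_const assms ptime_polyb)+
  then show ?thesis using ptime_rev by (fastforce simp: fold_filter)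
qed

lemma fold_map: "fold (\<lambda>y ys. h y # ys) xs zs = rev (map h xs) @ zs"
  by (induction xs arbitrary: zs) auto

text \<open>List elements are smaller than the list, so one polynomial \<open>M\<close> bounds all
  images, and the accumulator is bounded by its length times \<open>M\<close>.\<close>

lemma ptime_map:
  assumes "ptime (\<lambda>z. h (fst z) (snd z))" "ptime f"
  shows "ptime (\<lambda>x. map (h x) (f x))"
proof -
  have h: "ptime (\<lambda>z. h (fst (fst z)) (snd (fst z)))"
    by (rule ptime_comp[OF assms(1)]) (intro ptime_fst ptime_id)
  obtain k where k: "\<And>z. tsize (enc (h (fst z) (snd z))) \<le> (tsize (enc z) + 2) ^ k"
    using ptime_polyb[OF assms(1)] unfolding polyb_def by blast
  define M where "M x = (tsize (enc x) + tsize (enc (f x)) + 3) ^ k" for x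
  have "ptime (\<lambda>x. fold (\<lambda>y ys. h x y # ys) (f x) [])"
  proof (rule ptime_fold)
    show "polyb (\<lambda>x. 1 + tsize (enc (f x)) * (1 + M x))"
      unfolding M_def by (intro polyb_intros ptime_polyb assms)
    show "tsize (enc (fold (\<lambda>y ys. h x y # ys) l [])) \<le> 1 + tsize (enc (f x)) * (1 + M x)"
      if l: "f x = l @ l'" for x l l'
    proof -
      have "tsize (enc (h x y)) \<le> M x" if "y \<in> set l" for y
      proof -
        have "tsize (enc (x, y)) + 2 \<le> tsize (enc x) + tsize (enc (f x)) + 3"
          using tsize_elem[of y "f x"] that l by auto
        then have "(tsize (enc (x, y)) + 2) ^ k \<le> M x"
          unfolding M_def by (rule power_mono) simp
        then show ?thesis using k[of "(x, y)"] by simp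
      qed
      then have "tsize (enc (map (h x) l)) \<le> 1 + length (map (h x) l) * (1 + M x)"
        by (intro tsize_enc_le) auto
      moreover have "length (map (h x) l) \<le> tsize (enc (f x))"
        using length_less_tsize[of "f x"] l by simp
      ultimately show ?thesis
        unfolding fold_map append_Nil2 tsize_enc_rev
        by (meson add_le_mono1 mult_le_mono1 le_trans add_left_mono)
    qed
  qed (intro ptime_Cons h ptime_fst ptime_snd ptime_id ptime_const assms)+
  then show ?thesis using ptime_rev by (fastforce simp: fold_map)
qed

lemma fold_append: "fold (\<lambda>xs acc. acc @ xs) xss zs = zs @ concat xss"
  by (induction xss arbitrary: zs) auto

lemma tsize_enc_concat: "tsize (enc (concat xss)) \<le> tsize (enc xss)"
proof (induction xss)
  case (Cons xs xss)
  then show ?case using tsize_enc_append[of xs "concat xss"] by simp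
qed simp

lemma ptime_concat:
  assumes "ptime f" shows "ptime (\<lambda>x. concat (f x))"
proof -
  have "ptime (\<lambda>x. fold (\<lambda>xs acc. acc @ xs) (f x) [])"
  proof (rule ptime_fold)
    show "tsize (enc (fold (\<lambda>xs acc. acc @ xs) l [])) \<le> tsize (enc (f x))"
      if "f x = l @ l'" for x l l'
      using tsize_append_le1[of l l'] tsize_enc_concat[of l]
      unfolding fold_append that by simp
  qed (intro ptime_append ptime_fst ptime_snd ptime_id ptime_const assms ptime_polyb)+
  then show ?thesis by (simp add: fold_append)
qed

lemma ptime_product:
  assumes "ptime f" "ptime g" shows "ptime (\<lambda>x. List.product (f x) (g x))"
proof -
  have "ptime (\<lambda>x. concat (map (\<lambda>y. map (\<lambda>z. (y, z)) (g x)) (f x)))"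
    by (intro ptime_concat ptime_map ptime_Pair ptime_fst ptime_snd ptime_id assms
      ptime_comp[OF assms(2)])
  moreover have "List.product xs ys = concat (map (\<lambda>y. map (\<lambda>z. (y, z)) ys) xs)"
    for xs :: "'b list" and ys :: "'c list"
    by (induction xs) auto
  ultimately show ?thesis by simp
qed

text \<open>Here \<open>n\<close> is a constant of the program and becomes the degree of the bound;
  with \<open>n\<close> as part of the input the output would be exponential.\<close>

lemma ptime_n_lists:
  assumes "ptime f" shows "ptime (\<lambda>x. List.n_lists n (f x))"
proof (induction n)
  case 0
  then show ?case by (simp add: ptime_const)
next
  case (Suc n)
  have "ptime (\<lambda>x. concat (map (\<lambda>ys. map (\<lambda>y. y # ys) (f x)) (List.n_lists n (f x))))"
    by (intro ptime_concat ptime_map ptime_Cons ptime_fst ptime_snd ptime_id Suc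
      ptime_comp[OF assms])
  then show ?case by simp
qed

lemma fold_disj: "fold (\<lambda>y b. b \<or> P y) xs b \<longleftrightarrow> b \<or> (\<exists>y \<in> set xs. P y)"
  by (induction xs arbitrary: b) auto

lemma ptime_ex:
  assumes "ptime (\<lambda>z. P (fst z) (snd z))" "ptime f"
  shows "ptime (\<lambda>x. \<exists>y \<in> set (f x). P x y)"
proof -
  have P: "ptime (\<lambda>z. P (fst (fst z)) (snd (fst z)))"
    by (rule ptime_comp[OF assms(1)]) (intro ptime_fst ptime_id)
  have "ptime (\<lambda>x. fold (\<lambda>y b. b \<or> P x y) (f x) False)"
  proof (rule ptime_fold)
    show "polyb (\<lambda>x. 3)" by (rule polyb_const)
  qed (intro ptime_disj P ptime_snd ptime_id ptime_const assms tsize_enc_bool)+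
  then show ?thesis by (simp add: fold_disj)
qed

lemma ptime_all:
  assumes "ptime (\<lambda>z. P (fst z) (snd z))" "ptime f"
  shows "ptime (\<lambda>x. \<forall>y \<in> set (f x). P x y)"
  using ptime_not[OF ptime_ex[OF ptime_not[OF assms(1)] assms(2)]] by simp

lemma ptime_null:
  assumes "ptime f" shows "ptime (\<lambda>x. f x = [])"
proof -
  have "ptime (\<lambda>x. \<forall>y \<in> set (f x). False)"
    by (intro ptime_all ptime_const assms)
  then show ?thesis by simp
qed

subsection \<open>Numbers\<close>

lemma ptime_Suc: "ptime f \<Longrightarrow> ptime (\<lambda>x. Suc (f x))"
  by (rule ptime_expr_comp[of _ "Pair Leaf (Var 0)"]) (auto simp: enc_nat_def)

lemma fold_Suc: "fold (\<lambda>y n. Suc n) xs n = n + length xs"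
  by (induction xs arbitrary: n) auto

lemma ptime_length:
  assumes "ptime f" shows "ptime (\<lambda>x. length (f x))"
proof -
  have "ptime (\<lambda>x. fold (\<lambda>y n. Suc n) (f x) 0)"
  proof (rule ptime_fold)
    show "polyb (\<lambda>x. 2 * tsize (enc (f x)) + 1)" by (intro polyb_intros ptime_polyb assms)
    show "tsize (enc (fold (\<lambda>y n. Suc n) l (0 :: nat))) \<le> 2 * tsize (enc (f x)) + 1"
      if "f x = l @ l'" for x l l'
      using length_less_tsize[of "f x"] that by (simp add: fold_Suc)
  qed (intro ptime_Suc ptime_snd ptime_id ptime_const assms)+
  then show ?thesis by (simp add: fold_Suc)
qed

text \<open>A unary number is literally a list of units, so passing from a number to such a list
  changes nothing in memory, and arithmetic reduces to list processing.\<close>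

lemma enc_replicate_unit: "enc (replicate n ()) = enc n"
  by (induction n) (auto simp: enc_nat_def enc_unit_def)

lemma ptime_units: "ptime f \<Longrightarrow> ptime (\<lambda>x. replicate (f x) ())"
  by (rule ptime_expr_comp[of _ "Var 0"]) (auto simp: enc_replicate_unit)

lemma ptime_plus:
  assumes "ptime f" "ptime g" shows "ptime (\<lambda>x. f x + (g x :: nat))"
proof -
  have "ptime (\<lambda>x. length (replicate (f x) () @ replicate (g x) ()))"
    by (intro ptime_length ptime_append ptime_units assms)
  then show ?thesis by simp
qed

lemma ptime_drop:
  assumes "ptime n" "ptime f" shows "ptime (\<lambda>x. drop (n x) (f x))"
proof -
  have fold_tl: "fold (\<lambda>y. tl) us xs = drop (length us) xs" for us :: "unit list" and xs :: "'b list"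
    by (induction us arbitrary: xs) (auto simp: drop_Suc)
  have "ptime (\<lambda>x. fold (\<lambda>y. tl) (replicate (n x) ()) (f x))"
  proof (rule ptime_fold)
    show "tsize (enc (fold (\<lambda>y. tl) l (f x))) \<le> tsize (enc (f x))" for x and l :: "unit list"
      unfolding fold_tl using tsize_append_le2[of "drop (length l) (f x)" "take (length l) (f x)"]
      by simp
  qed (intro ptime_tl ptime_snd ptime_id ptime_units ptime_polyb assms)+
  then show ?thesis unfolding fold_tl length_replicate .
qed

lemma ptime_minus:
  assumes "ptime f" "ptime g" shows "ptime (\<lambda>x. f x - (g x :: nat))"
proof -
  have "ptime (\<lambda>x. length (drop (g x) (replicate (f x) ())))"
    by (intro ptime_length ptime_drop ptime_units assms)
  then show ?thesis by simp
qed

lemma ptime_le: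
  assumes "ptime f" "ptime g" shows "ptime (\<lambda>x. f x \<le> (g x :: nat))"
proof -
  have "ptime (\<lambda>x. drop (g x) (replicate (f x) ()) = [])"
    by (intro ptime_null ptime_drop ptime_units assms)
  then show ?thesis by simp
qed

lemma ptime_less: "ptime f \<Longrightarrow> ptime g \<Longrightarrow> ptime (\<lambda>x. f x < (g x :: nat))"
  using ptime_not[OF ptime_le[of g f]] by (simp add: not_le)

lemma ptime_eq_nat: "ptime f \<Longrightarrow> ptime g \<Longrightarrow> ptime (\<lambda>x. f x = (g x :: nat))"
  using ptime_conj[OF ptime_le[of f g] ptime_le[of g f]] by (simp add: order_eq_iff)

lemma ptime_upt:
  assumes "ptime f" shows "ptime (\<lambda>x. [0..<f x])"
proof -
  have fold_upt: "fold (\<lambda>y acc. length acc # acc) us [] = rev [0..<length us]" for us :: "unit list"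
    by (induction us rule: rev_induct) auto
  have "ptime (\<lambda>x. fold (\<lambda>y acc. length acc # acc) (replicate (f x) ()) [])"
  proof (rule ptime_fold)
    show "polyb (\<lambda>x. 1 + tsize (enc (f x)) * (1 + (2 * tsize (enc (f x)) + 1)))"
      by (intro polyb_intros ptime_polyb assms)
    fix x and l l' :: "unit list" assume "replicate (f x) () = l @ l'"
    from arg_cong[OF this, of length] have l: "length l \<le> f x" by simp
    have "tsize (enc (rev [0..<length l])) \<le> 1 + length (rev [0..<length l]) * (1 + (2 * f x + 1))"
      by (intro tsize_enc_le) (use l in auto)
    also have "\<dots> \<le> 1 + tsize (enc (f x)) * (1 + (2 * tsize (enc (f x)) + 1))"
      using l by (intro add_mono mult_le_mono) auto
    finally show "tsize (enc (fold (\<lambda>y acc. length acc # acc) l [])) \<le>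
        1 + tsize (enc (f x)) * (1 + (2 * tsize (enc (f x)) + 1))"
      unfolding fold_upt .
  qed (intro ptime_Cons ptime_length ptime_snd ptime_id ptime_const ptime_units assms)+
  then have "ptime (\<lambda>x. rev (rev [0..<f x]))"
    unfolding fold_upt length_replicate by (rule ptime_rev)
  then show ?thesis by simp
qed

text \<open>A program has to compute a specified value on every input, whereas \<open>!\<close> is
  unspecified out of range; hence the explicit default.\<close>

definition nthd :: "'a \<Rightarrow> 'a list \<Rightarrow> nat \<Rightarrow> 'a" where
  "nthd d xs n = (if n < length xs then xs ! n else d)"

lemma nthd_less [simp]: "n < length xs \<Longrightarrow> nthd d xs n = xs ! n"
  by (simp add: nthd_def)

lemma ptime_nthd:
  assumes "ptime d" "ptime f" "ptime n" shows "ptime (\<lambda>x. nthd (d x) (f x) (n x))"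
proof -
  have fold_last: "fold (\<lambda>y a. y) xs d = (if xs = [] then d else last xs)" for xs and d :: 'b
    by (induction xs arbitrary: d) auto
  have "ptime (\<lambda>x. fold (\<lambda>y a. y) (rev (drop (n x) (f x))) (d x))"
  proof (rule ptime_fold)
    show "polyb (\<lambda>x. tsize (enc (d x)) + tsize (enc (rev (drop (n x) (f x)))))"
      by (intro polyb_intros ptime_polyb ptime_rev ptime_drop assms)
    fix x and l l' assume l: "rev (drop (n x) (f x)) = l @ l'"
    have "tsize (enc (last l)) < tsize (enc (rev (drop (n x) (f x))))" if "l \<noteq> []"
      unfolding l using that by (intro tsize_elem) auto
    then show "tsize (enc (fold (\<lambda>y a. y) l (d x))) \<le>
        tsize (enc (d x)) + tsize (enc (rev (drop (n x) (f x))))"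
      unfolding fold_last by (auto simp: less_imp_le trans_le_add2)
  qed (intro ptime_fst ptime_snd ptime_id ptime_rev ptime_drop assms)+
  moreover have "fold (\<lambda>y a. y) (rev (drop n xs)) d = nthd d xs n" for n xs and d :: 'b
    unfolding fold_last nthd_def by (auto simp: last_rev hd_drop_conv_nth)
  ultimately show ?thesis by simp
qed

lemma ptime_eq_nat_list:
  assumes "ptime f" "ptime g" shows "ptime (\<lambda>x. f x = (g x :: nat list))"
proof -
  have "ptime (\<lambda>x. length (f x) = length (g x) \<and>
      (\<forall>i \<in> set [0..<length (f x)]. nthd 0 (f x) i = nthd 0 (g x) i))"
    by (intro ptime_conj ptime_all ptime_eq_nat ptime_length ptime_upt ptime_nthd ptime_const
      ptime_snd ptime_id assms ptime_comp[OF assms(1)] ptime_comp[OF assms(2)] ptime_fst)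
  moreover have "f x = g x \<longleftrightarrow> length (f x) = length (g x) \<and>
      (\<forall>i \<in> set [0..<length (f x)]. nthd 0 (f x) i = nthd 0 (g x) i)" for x
    by (subst list_eq_iff_nth_eq) (auto simp: nthd_def)
  ultimately show ?thesis by simp
qed

lemma ptime_distinct_nat:
  assumes "ptime f" shows "ptime (\<lambda>x. distinct (f x :: nat list))"
proof -
  have f: "ptime (\<lambda>z. f (fst (fst z)))" "ptime (\<lambda>z. f (fst z))"
    by (intro ptime_comp[OF assms] ptime_fst ptime_id)+
  have "ptime (\<lambda>x. \<forall>i \<in> set [0..<length (f x)]. \<forall>j \<in> set [0..<length (f x)].
      i = j \<or> nthd 0 (f x) i \<noteq> nthd 0 (f x) j)"
    by (intro ptime_all ptime_disj ptime_not ptime_eq_nat ptime_length ptime_upt ptime_nthd ptime_const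
      ptime_fst ptime_snd ptime_id assms f)
  moreover have "distinct (f x) \<longleftrightarrow> (\<forall>i \<in> set [0..<length (f x)]. \<forall>j \<in> set [0..<length (f x)].
      i = j \<or> nthd 0 (f x) i \<noteq> nthd 0 (f x) j)" (is "_ \<longleftrightarrow> ?R") for x
  proof
    assume R: ?R
    have "f x ! i \<noteq> f x ! j" if "i < length (f x)" "j < length (f x)" "i \<noteq> j" for i j
      using R[rule_format, of i j] that by simp
    then show "distinct (f x)" unfolding distinct_conv_nth by blast
  qed (auto simp: nth_eq_iff_index_eq)
  ultimately show ?thesis by simp
qed

section \<open>Circuits of small depth and weft\<close>

lemma wf_circuit_gate:
  assumes "wf_circuit C" "i < length C"
  shows "fan_in_ok (C ! i)" "distinct (preds (C ! i))" "\<And>j. j \<in> set (preds (C ! i)) \<Longrightarrow> j < i"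
    "\<And>j. j \<in> set (preds (C ! i)) \<Longrightarrow> j < length C"
  using assms unfolding wf_circuit_def by fastforce+

lemma preds_Nil_iff: "fan_in_ok g \<Longrightarrow> preds g = [] \<longleftrightarrow> g = Input"
  by (cases g) auto

text \<open>This is \<open>input_output_path\<close> with a free endpoint, so that induction over
  nodes becomes possible.\<close>

definition path_to :: "circuit \<Rightarrow> nat \<Rightarrow> nat list \<Rightarrow> bool" where
  "path_to C i p \<longleftrightarrow> p \<noteq> [] \<and> hd p \<in> input_nodes C \<and> last p = i \<and>
     successively (\<lambda>i j. j < length C \<and> i \<in> set (preds (C ! j))) p"

lemma path_to_iff:
  assumes "i < length C"
  shows "path_to C i p \<longleftrightarrow> (C ! i = Input \<and> p = [i]) \<or>
    (\<exists>j \<in> set (preds (C ! i)). \<exists>p'. path_to C j p' \<and> p = p' @ [i])"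
proof
  assume p: "path_to C i p"
  then obtain p' where p': "p = p' @ [i]"
    unfolding path_to_def by (metis append_butlast_last_id)
  show "(C ! i = Input \<and> p = [i]) \<or> (\<exists>j \<in> set (preds (C ! i)). \<exists>p'. path_to C j p' \<and> p = p' @ [i])"
  proof (cases "p' = []")
    case True
    then show ?thesis using p p' by (auto simp: path_to_def input_nodes_def)
  next
    case False
    then have "path_to C (last p') p'" "last p' \<in> set (preds (C ! i))"
      using p p' by (auto simp: path_to_def successively_append_iff)
    then show ?thesis using p' by blast
  qed
next
  assume "(C ! i = Input \<and> p = [i]) \<or> (\<exists>j \<in> set (preds (C ! i)). \<exists>p'. path_to C j p' \<and> p = p' @ [i])"
  then show "path_to C i p"
    using assms by (auto simp: path_to_def successively_append_iff input_nodes_def)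
qed

text \<open>Every gate other than an input has a predecessor, so walking backwards ends at an input.
  Without such paths the depth and weft conditions would hold vacuously and could not be matched by
  a recursive test.\<close>

lemma ex_path_to: "wf_circuit C \<Longrightarrow> i < length C \<Longrightarrow> \<exists>p. path_to C i p"
proof (induction i rule: less_induct)
  case (less i)
  show ?case
  proof (cases "C ! i = Input")
    case True
    then show ?thesis using less by (auto simp: path_to_iff)
  next
    case False
    then obtain j where "j \<in> set (preds (C ! i))"
      using preds_Nil_iff wf_circuit_gate(1) less by (metis ex_in_conv set_empty)
    then show ?thesis
      using less wf_circuit_gate[OF less.prems] path_to_iff[OF less.prems(2)] by metis
  qed
qed

text \<open>With well-formed circuits, input gates are exactly the gates without predecessors.\<close>

fun shallow :: "nat \<Rightarrow> nat \<Rightarrow> circuit \<Rightarrow> nat \<Rightarrow> bool" where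
  "shallow w 0 C i \<longleftrightarrow> preds (nthd Input C i) = []"
| "shallow w (Suc d) C i \<longleftrightarrow> (let js = preds (nthd Input C i) in js = [] \<or>
     (if 2 < length js then 0 < w \<and> (\<forall>j \<in> set js. shallow (w - 1) d C j)
      else \<forall>j \<in> set js. shallow w d C j))"

text \<open>The conditions on all paths are checked by a recursion that spends a depth budget at
  every edge and a weft budget at every large gate. For constant \<open>d\<close> this recursion
  takes polynomial time.\<close>

lemma shallow_iff:
  assumes "wf_circuit C" "i < length C"
  shows "shallow w d C i \<longleftrightarrow> (\<forall>p. path_to C i p \<longrightarrow>
    length p - 1 \<le> d \<and> length (filter (\<lambda>i. large (C ! i)) p) \<le> w)"
  using assms(2)
proof (induction d arbitrary: w i)
  case (0 w i)
  note g = wf_circuit_gate[OF assms(1) 0]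
  show ?case
  proof (cases "C ! i = Input")
    case True
    then show ?thesis using 0 by (auto simp: path_to_iff large_def)
  next
    case False
    then obtain j where j: "j \<in> set (preds (C ! i))"
      using preds_Nil_iff g(1) by (metis ex_in_conv set_empty)
    then obtain p where "path_to C j p" using ex_path_to assms(1) g(4) by blast
    then have "path_to C i (p @ [i])" "p \<noteq> []"
      using path_to_iff[OF 0] j by (auto simp: path_to_def)
    then show ?thesis using False 0 preds_Nil_iff[OF g(1)] by fastforce
  qed
next
  case (Suc d w i)
  note g = wf_circuit_gate[OF assms(1) Suc.prems]
  let ?c = "\<lambda>p. length (filter (\<lambda>i. large (C ! i)) p)"
  show ?case
  proof (cases "C ! i = Input")
    case True
    then show ?thesis using Suc.prems by (auto simp: path_to_iff large_def)
  next
    case False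
    then obtain j0 where j0: "j0 \<in> set (preds (C ! i))"
      using preds_Nil_iff g(1) by (metis ex_in_conv set_empty)
    then obtain p0 where p0: "path_to C j0 p0" using ex_path_to assms(1) g(4) by blast
    have path: "path_to C i p \<longleftrightarrow> (\<exists>j \<in> set (preds (C ! i)). \<exists>p'. path_to C j p' \<and> p = p' @ [i])" for p
      using path_to_iff[OF Suc.prems] False by blast
    have len: "length p - 1 \<le> d \<longleftrightarrow> length p \<le> Suc d" for p :: "nat list" by auto
    have "(\<forall>p. path_to C i p \<longrightarrow> length p - 1 \<le> Suc d \<and> ?c p \<le> w) \<longleftrightarrow>
      (\<forall>j \<in> set (preds (C ! i)). \<forall>p. path_to C j p \<longrightarrow>
        length p - 1 \<le> d \<and> ?c p + (if large (C ! i) then 1 else 0) \<le> w)"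
      unfolding path len by fastforce
    also have "\<dots> \<longleftrightarrow> (if large (C ! i) then 0 < w \<and> (\<forall>j \<in> set (preds (C ! i)). shallow (w - 1) d C j)
      else \<forall>j \<in> set (preds (C ! i)). shallow w d C j)"
    proof (cases "large (C ! i)")
      case True
      \<comment> \<open>Subtraction is truncated, so \<open>0 < w\<close> has to be obtained
        separately; the path \<open>p0\<close> provides it.\<close>
      have "?c p + 1 \<le> w \<longleftrightarrow> 0 < w \<and> ?c p \<le> w - 1" for p by auto
      then show ?thesis
        using True p0 j0 Suc.IH[OF g(4)] by auto
    qed (use Suc.IH[OF g(4)] in auto)
    finally show ?thesis
      using Suc.prems False preds_Nil_iff[OF g(1)] by (simp add: large_def Let_def)
  qed
qed

lemma wf_output: "wf_circuit C \<Longrightarrow> output_node C < length C"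
  by (auto simp: wf_circuit_def output_node_def)

lemma shallow_output_iff:
  "wf_circuit C \<Longrightarrow>
    shallow w d C (output_node C) \<longleftrightarrow> weft_at_most w C \<and> depth_at_most d C"
  by (auto simp: shallow_iff wf_output weft_at_most_def depth_at_most_def input_output_path_def path_to_def)

fun gate_tag :: "gate \<Rightarrow> nat" where
  "gate_tag Input = 0"
| "gate_tag (Neg j) = 1"
| "gate_tag (Conj js) = 2"
| "gate_tag (Disj js) = 3"

text \<open>By De Morgan duality, a conjunction that should be true and a disjunction that should be
  false behave alike: all predecessors must have value \<open>pol\<close>. In the two other cases
  one suffices. Comparing the tag test with \<open>pol\<close> merges these cases.\<close>

lemma node_value_cases:
  assumes "wf_circuit C" "i < length C"
  defines "js \<equiv> preds (C ! i)"
  shows "js = [] \<Longrightarrow> node_value C S i \<longleftrightarrow> i \<in> S"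
    "length js = 1 \<Longrightarrow> node_value C S i \<longleftrightarrow> \<not> node_value C S (js ! 0)"
    "2 \<le> length js \<Longrightarrow> (gate_tag (C ! i) = 2) = pol \<Longrightarrow>
       node_value C S i = pol \<longleftrightarrow> (\<forall>j \<in> set js. node_value C S j = pol)"
    "2 \<le> length js \<Longrightarrow> (gate_tag (C ! i) = 2) \<noteq> pol \<Longrightarrow>
       node_value C S i = pol \<longleftrightarrow> (\<exists>j \<in> set js. node_value C S j = pol)"
  using wf_circuit_gate[OF assms(1,2)]
  by (cases "C ! i"; simp add: js_def node_value.simps[of C S i]; fastforce)+

subsection \<open>Refutation by a partial view\<close>

text \<open>
  An entry \<open>u # v # _\<close> of a view \<open>V\<close> says that, of the nodes \<open>i\<close> with \<open>u \<le> i + 1 < v\<close>,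
  only the node \<open>u - 1\<close> is set to true (none if \<open>u = 0\<close>). The list \<open>g\<close> names, in preorder
  of the unfolded circuit, the position of the predecessor that is claimed to be responsible
  for the value of a large gate. Refutation is three-valued evaluation; thanks to \<open>g\<close>, every
  refutation only needs a bounded part of the view.
\<close>

definition lit_refuted :: "nat list list \<Rightarrow> bool \<Rightarrow> nat \<Rightarrow> bool" where
  "lit_refuted V pol i \<longleftrightarrow> (\<exists>a \<in> set V.
     nthd 0 a 0 \<le> i + 1 \<and> i + 1 < nthd 0 a 1 \<and> (nthd 0 a 0 = i + 1) \<noteq> pol)"

text \<open>The entries are the nodes of a complete binary tree: one for the gate itself and one
  block for each of two predecessors. Wide gates get by with this, since with weft 1 nothing remains
  to be guessed below a large gate and all its predecessors can share \<open>tl g\<close>.\<close>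

fun guess_length :: "nat \<Rightarrow> nat" where
  "guess_length 0 = 0"
| "guess_length (Suc d) = Suc (guess_length d + guess_length d)"

fun refuted :: "nat \<Rightarrow> circuit \<Rightarrow> nat list list \<Rightarrow> nat list \<Rightarrow> bool \<Rightarrow> nat \<Rightarrow> bool" where
  "refuted 0 C V g pol i \<longleftrightarrow> lit_refuted V pol i"
| "refuted (Suc d) C V g pol i \<longleftrightarrow> (let G = nthd Input C i; js = preds G; h = drop (Suc (guess_length d)) g in
     if js = [] then lit_refuted V pol i
     else if length js = 1 then refuted d C V (tl g) (\<not> pol) (nthd 0 js 0)
     else if (gate_tag G = 2) = pol then
       (if 2 < length js then \<exists>j \<in> set js. refuted d C V (tl g) pol j
        else refuted d C V (tl g) pol (nthd 0 js 0) \<or> refuted d C V h pol (nthd 0 js 1))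
     else if 2 < length js then
       length js \<le> nthd 0 g 0 \<or> refuted d C V (tl g) pol (nthd 0 js (nthd 0 g 0))
     else refuted d C V (tl g) pol (nthd 0 js 0) \<and> refuted d C V h pol (nthd 0 js 1))"

lemma refuted_mono:
  assumes "\<And>pol i. lit_refuted V pol i \<Longrightarrow> lit_refuted W pol i"
  shows "refuted d C V g pol i \<Longrightarrow> refuted d C W g pol i"
proof (induction d arbitrary: g pol i)
  case 0
  then show ?case using assms by simp
next
  case (Suc d)
  show ?case
    using Suc.prems Suc.IH assms[of pol i] by (auto simp: Let_def split: if_splits)
qed

lemma lit_refuted_mono: "lit_refuted V pol i \<Longrightarrow> set V \<subseteq> set W \<Longrightarrow> lit_refuted W pol i"
  by (auto simp: lit_refuted_def)

text \<open>A large gate is refuted through at most one predecessor, either some refuted one or the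
  guessed one. Only a gate with two predecessors may need both refuted, so a refutation is a binary
  tree of depth at most \<open>d\<close> with at most \<open>2 ^ d\<close> leaves, each using one
  entry of the view.\<close>

lemma refuted_compact:
  "refuted d C V g pol i \<Longrightarrow>
     \<exists>W. set W \<subseteq> set V \<and> length W \<le> 2 ^ d \<and> refuted d C W g pol i"
proof (induction d arbitrary: g pol i)
  case 0
  then obtain a where "a \<in> set V" "lit_refuted [a] pol i"
    by (auto simp: lit_refuted_def)
  then show ?case by (intro exI[of _ "[a]"]) auto
next
  case (Suc d)
  let ?js = "preds (nthd Input C i)" and ?h = "drop (Suc (guess_length d)) g"
  consider
    (lit) "lit_refuted V pol i" "?js = []"
  | (one) g' pol' j where "refuted d C V g' pol' j"
      "\<And>W. refuted d C W g' pol' j \<Longrightarrow> refuted (Suc d) C W g pol i"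
  | (two) j j' where "refuted d C V (tl g) pol j" "refuted d C V ?h pol j'"
      "\<And>W. refuted d C W (tl g) pol j \<Longrightarrow> refuted d C W ?h pol j' \<Longrightarrow> refuted (Suc d) C W g pol i"
  | (none) "\<And>W. refuted (Suc d) C W g pol i"
    using Suc.prems by (fastforce simp: Let_def split: if_splits)
  then show ?case
  proof cases
    case lit
    then obtain a where "a \<in> set V" "lit_refuted [a] pol i"
      by (auto simp: lit_refuted_def)
    then show ?thesis using lit by (intro exI[of _ "[a]"]) auto
  next
    case one
    from Suc.IH[OF one(1)] obtain W where
      "set W \<subseteq> set V" "length W \<le> 2 ^ d" "refuted d C W g' pol' j" by blast
    then show ?thesis using one(2) by (intro exI[of _ W]) auto
  next
    case two
    from Suc.IH[OF two(1)] obtain W where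
      W: "set W \<subseteq> set V" "length W \<le> 2 ^ d" "refuted d C W (tl g) pol j" by blast
    from Suc.IH[OF two(2)] obtain W' where
      W': "set W' \<subseteq> set V" "length W' \<le> 2 ^ d" "refuted d C W' ?h pol j'" by blast
    have "refuted (Suc d) C (W @ W') g pol i"
      by (intro two(3) refuted_mono[OF _ W(3)] refuted_mono[OF _ W'(3)]) (auto elim: lit_refuted_mono)
    then show ?thesis using W W' by (intro exI[of _ "W @ W'"]) auto
  next
    case none
    then show ?thesis by (intro exI[of _ "[]"]) auto
  qed
qed

context
  fixes C :: circuit and V :: "nat list list" and S :: "nat set"
  assumes wf: "wf_circuit C"
    and decides: "\<And>i pol. i \<in> input_nodes C \<Longrightarrow> lit_refuted V pol i \<longleftrightarrow> (i \<in> S) \<noteq> pol"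
begin

lemma lit_refuted_iff:
  assumes "i < length C" "preds (C ! i) = []"
  shows "lit_refuted V pol i \<longleftrightarrow> node_value C S i \<noteq> pol"
  using assms decides[of i pol] node_value_cases(1)[OF wf assms(1)]
    preds_Nil_iff[OF wf_circuit_gate(1)[OF wf assms(1)]]
  by (auto simp: input_nodes_def)

lemma length_two_cases:
  assumes "js \<noteq> []" "length js \<noteq> 1" "\<not> 2 < length js"
  obtains j j' where "js = [j, j']"
  using assms by (cases js rule: remdups_adj.cases) auto

text \<open>Below a large gate there is no choice to guess, and a view that decides all inputs turns
  three-valued evaluation into ordinary evaluation, in both directions.\<close>

lemma refuted_small:
  "shallow 0 d C i \<Longrightarrow> i < length C \<Longrightarrow> refuted d C V g pol i \<longleftrightarrow> node_value C S i \<noteq> pol"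
proof (induction d arbitrary: g pol i)
  case 0
  then show ?case using lit_refuted_iff by simp
next
  case (Suc d)
  let ?js = "preds (C ! i)"
  note nv = node_value_cases[OF wf Suc.prems(2), where S = S]
  have IH: "refuted d C V g' pol' j \<longleftrightarrow> node_value C S j \<noteq> pol'" if "j \<in> set ?js" for g' pol' j
    using that Suc wf_circuit_gate(4)[OF wf Suc.prems(2)] by (auto simp: Let_def split: if_splits)
  consider "?js = []" | "length ?js = 1" | "?js \<noteq> []" "length ?js \<noteq> 1" by blast
  then show ?case
  proof cases
    case 1
    then show ?thesis using Suc.prems lit_refuted_iff by simp
  next
    case 2
    then obtain j where "?js = [j]" by (auto simp: length_Suc_conv)
    then show ?thesis using Suc.prems nv(2) IH by (simp add: Let_def)
  next
    case 3
    then have "\<not> 2 < length ?js" using Suc.prems by (auto simp: Let_def)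
    then obtain j j' where "?js = [j, j']" using 3 length_two_cases by metis
    then show ?thesis
      using Suc.prems nv(3,4)[of pol] IH by (cases "(gate_tag (C ! i) = 2) = pol") (auto simp: Let_def)
  qed
qed

text \<open>A guessed predecessor that survives really has the wanted value by
  \<open>refuted_small\<close>, and a guess out of range counts as refuted. There is no converse for
  a fixed \<open>g\<close>, since a wrong guess can refute a correct value.\<close>

lemma not_refuted_sound:
  "shallow 1 d C i \<Longrightarrow> i < length C \<Longrightarrow> \<not> refuted d C V g pol i \<Longrightarrow> node_value C S i = pol"
proof (induction d arbitrary: g pol i)
  case 0
  then show ?case using lit_refuted_iff by simp
next
  case (Suc d)
  let ?js = "preds (C ! i)"
  note nv = node_value_cases[OF wf Suc.prems(2), where S = S]
  note lt = wf_circuit_gate(4)[OF wf Suc.prems(2)]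
  have IH: "node_value C S j = pol'"
    if "\<not> refuted d C V g' pol' j" "j \<in> set ?js" "\<not> 2 < length ?js" for g' pol' j
    using that Suc lt by (auto simp: Let_def split: if_splits)
  consider "?js = []" | "length ?js = 1" | "?js \<noteq> []" "length ?js \<noteq> 1" "\<not> 2 < length ?js" | "2 < length ?js"
    by blast
  then show ?case
  proof cases
    case 1
    then show ?thesis using Suc.prems lit_refuted_iff by simp
  next
    case 2
    then obtain j where "?js = [j]" by (auto simp: length_Suc_conv)
    then show ?thesis using Suc.prems nv(2) IH by (auto simp: Let_def)
  next
    case 3
    then obtain j j' where "?js = [j, j']" using length_two_cases by metis
    then show ?thesis
      using Suc.prems nv(3,4)[of pol] IH by (cases "(gate_tag (C ! i) = 2) = pol") (auto simp: Let_def)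
  next
    case 4
    then have small: "refuted d C V g' pol' j \<longleftrightarrow> node_value C S j \<noteq> pol'" if "j \<in> set ?js" for g' pol' j
      using that Suc.prems lt refuted_small by (auto simp: Let_def split: if_splits)
    have "?js \<noteq> []" "length ?js \<noteq> 1" using 4 by auto
    then show ?thesis
      using Suc.prems nv(3,4)[of pol] small 4
      by (cases "(gate_tag (C ! i) = 2) = pol") (auto simp: Let_def not_le)
  qed
qed

text \<open>The continuation \<open>h\<close> is needed because the first predecessor receives all
  of \<open>tl g\<close>, that is, its own block followed by that of the second.\<close>

lemma not_refuted_complete:
  "shallow 1 d C i \<Longrightarrow> i < length C \<Longrightarrow> node_value C S i = pol \<Longrightarrow>
     \<exists>g. length g = guess_length d \<and> set g \<subseteq> {..<length C} \<and> (\<forall>h. \<not> refuted d C V (g @ h) pol i)"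
proof (induction d arbitrary: pol i)
  case 0
  then show ?case using lit_refuted_iff by simp
next
  case (Suc d)
  let ?js = "preds (C ! i)"
  let ?g0 = "replicate (guess_length d) (0 :: nat)"
  have C0: "0 < length C" using Suc.prems by auto
  note nv = node_value_cases[OF wf Suc.prems(2), where S = S]
  note lt = wf_circuit_gate(4)[OF wf Suc.prems(2)]
  have IH: "\<exists>g. length g = guess_length d \<and> set g \<subseteq> {..<length C} \<and> (\<forall>h. \<not> refuted d C V (g @ h) pol' j)"
    if "node_value C S j = pol'" "j \<in> set ?js" "\<not> 2 < length ?js" for pol' j
    using that Suc lt by (auto simp: Let_def split: if_splits)
  have g0: "set ?g0 \<subseteq> {..<length C}" using C0 by auto
  consider "?js = []" | "length ?js = 1" | "?js \<noteq> []" "length ?js \<noteq> 1" "\<not> 2 < length ?js" | "2 < length ?js"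
    by blast
  then show ?case
  proof cases
    case 1
    then show ?thesis using Suc.prems lit_refuted_iff g0 C0
      by (intro exI[of _ "0 # ?g0 @ ?g0"]) auto
  next
    case 2
    then obtain j where j: "?js = [j]" by (auto simp: length_Suc_conv)
    then obtain g where g: "length g = guess_length d" "set g \<subseteq> {..<length C}"
      "\<And>h. \<not> refuted d C V (g @ h) (\<not> pol) j"
      using IH[of j "\<not> pol"] Suc.prems nv(2) by auto
    then show ?thesis using j Suc.prems g0 C0
      by (intro exI[of _ "0 # g @ ?g0"]) (auto simp: Let_def)
  next
    case 3
    then obtain j j' where js: "?js = [j, j']" using length_two_cases by metis
    \<comment> \<open>Possibly only one of the two predecessors has value \<open>pol\<close>; the
      other one still gets a block, filled with zeros.\<close>
    have ex: "\<exists>g. length g = guess_length d \<and> set g \<subseteq> {..<length C} \<and>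
      (node_value C S j = pol \<longrightarrow> (\<forall>h. \<not> refuted d C V (g @ h) pol j))" if "j \<in> set ?js" for j
    proof (cases "node_value C S j = pol")
      case True
      then show ?thesis using IH[OF _ that 3(3)] by blast
    next
      case False
      then show ?thesis using g0 by (intro exI[of _ ?g0]) simp
    qed
    obtain g where g: "length g = guess_length d" "set g \<subseteq> {..<length C}"
      "\<And>h. node_value C S j = pol \<Longrightarrow> \<not> refuted d C V (g @ h) pol j"
      using ex[of j] js by auto
    obtain g' where g': "length g' = guess_length d" "set g' \<subseteq> {..<length C}"
      "\<And>h. node_value C S j' = pol \<Longrightarrow> \<not> refuted d C V (g' @ h) pol j'"
      using ex[of j'] js by auto
    show ?thesis
      using Suc.prems nv(3,4)[of pol] js g g' C0
      by (intro exI[of _ "0 # g @ g'"]) (cases "(gate_tag (C ! i) = 2) = pol"; auto simp: Let_def)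
  next
    case 4
    then have small: "refuted d C V g' pol' j \<longleftrightarrow> node_value C S j \<noteq> pol'" if "j \<in> set ?js" for g' pol' j
      using that Suc.prems lt refuted_small by (auto simp: Let_def split: if_splits)
    have ne: "?js \<noteq> []" "length ?js \<noteq> 1" using 4 by auto
    show ?thesis
    proof (cases "(gate_tag (C ! i) = 2) = pol")
      case True
      then show ?thesis
        using Suc.prems nv(3)[of pol] small 4 g0 C0 ne
        by (intro exI[of _ "0 # ?g0 @ ?g0"]) (auto simp: Let_def)
    next
      case False
      then obtain n where n: "n < length ?js" "node_value C S (?js ! n) = pol"
        using Suc.prems nv(4)[of pol] 4 by (auto simp: in_set_conv_nth)
      \<comment> \<open>Predecessors are distinct nodes, so a position among them is less than the
        number of nodes. This keeps guesses within the alphabet used for the agents.\<close>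
      have "length ?js \<le> length C"
        using distinct_card[of ?js] card_mono[of "{..<length C}" "set ?js"]
          wf_circuit_gate(2)[OF wf Suc.prems(2)] lt by auto
      then have "n < length C" using n(1) by simp
      then show ?thesis
        using Suc.prems small[of "?js ! n"] 4 g0 ne n False
        by (intro exI[of _ "n # ?g0 @ ?g0"]) (auto simp: Let_def)
    qed
  qed
qed

end

section \<open>Assignments as labellings\<close>

text \<open>
  A view is a list of pairs of an item and an agent. In the layer of a view, these agents accept
  exactly their item, all other agents accept exactly the items that do not occur in the view,
  and all lists have increasing order. An assignment that gives away all items is then Pareto
  optimal if and only if it extends the view.
\<close>

definition view_prefs :: "nat \<Rightarrow> (nat \<times> 'x) list \<Rightarrow> 'x \<Rightarrow> nat list" where
  "view_prefs m vw a = filter (\<lambda>i. \<forall>e \<in> set vw. (fst e = i) = (snd e = a)) [0..<m]"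

lemma set_view_prefs:
  "i \<in> set (view_prefs m vw a) \<longleftrightarrow> i < m \<and> (\<forall>e \<in> set vw. (fst e = i) = (snd e = a))"
  by (auto simp: view_prefs_def)

lemma less_pref_view_prefs:
  assumes "less_pref (view_prefs m vw a) (Some y) (Some z)" shows "z < y"
proof -
  have "sorted_wrt (<) (view_prefs m vw a)"
    unfolding view_prefs_def by (intro sorted_wrt_filter) simp
  then show ?thesis using assms sorted_wrt_nth_less by fastforce
qed

lemma less_pref_elem: "less_pref xs y (Some z) \<Longrightarrow> z \<in> set xs"
  by (cases y) auto

text \<open>A constraint satisfaction problem: items are variables, agents are values, and
  \<open>views\<close> lists the permitted choices for every \<open>q\<close>-tuple of variables,
  including tuples with repetitions.\<close>

definition labelling :: "nat \<Rightarrow> nat \<Rightarrow> (nat \<times> 'x) list list \<Rightarrow> (nat \<Rightarrow> 'x) \<Rightarrow> bool" where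
  "labelling m q views A \<longleftrightarrow> (\<forall>ts \<in> set (List.n_lists q [0..<m]). map (\<lambda>i. (i, A i)) ts \<in> set views)"

lemma card_n_lists: "card (set (List.n_lists q [0..<m])) = m ^ q"
  by (simp add: distinct_card distinct_n_lists length_n_lists)

text \<open>An instance in the shape of \<open>enc_goa\<close>, but with tables in place of
  functions; agents are identified with their positions in \<open>ags\<close>.\<close>

definition view_code :: "'x list \<Rightarrow> nat \<Rightarrow> nat \<Rightarrow> (nat \<times> 'x) list list \<Rightarrow> nat \<times> nat \<times> nat list list list \<times> nat" where
  "view_code ags m q views = (length ags, m, map (\<lambda>vw. map (view_prefs m vw) ags) views, m ^ q)"

lemma enc_nat_inj [simp]: "enc_nat x = enc_nat y \<longleftrightarrow> x = y"
proof (induction x arbitrary: y)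
  case 0
  then show ?case by (cases y) auto
next
  case (Suc x)
  then show ?case by (cases y) auto
qed

lemma enc_list_eq_iff: "enc_list f xs = enc_list g ys \<longleftrightarrow> list_all2 (\<lambda>x y. f x = g y) xs ys"
proof (induction xs arbitrary: ys)
  case Nil
  then show ?case by (cases ys) auto
next
  case (Cons x xs)
  then show ?case by (cases ys) auto
qed

section \<open>Optimal assignments correspond to labellings\<close>

context
  fixes ags :: "'x list" and m q :: nat and views :: "(nat \<times> 'x) list list"
  assumes ags: "distinct ags" and views: "distinct views" and q: "2 \<le> q" and m: "0 < m"
    and view_length: "\<And>vw. vw \<in> set views \<Longrightarrow> length vw = q"
    and view_elem: "\<And>vw i a. vw \<in> set views \<Longrightarrow> (i, a) \<in> set vw \<Longrightarrow> i < m \<and> a \<in> set ags"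
    and view_inj: "\<And>vw e e'. vw \<in> set views \<Longrightarrow> e \<in> set vw \<Longrightarrow> e' \<in> set vw \<Longrightarrow>
      (fst e = fst e') = (snd e = snd e')"
begin

context
  fixes G :: "(nat, nat) goa"
  assumes agents: "agents G = {..<length ags}" and items: "items G = {..<m}"
    and length_layers: "length (layers G) = length views"
    and layer: "\<And>j b. j < length views \<Longrightarrow> b < length ags \<Longrightarrow>
      (layers G ! j) b = view_prefs m (views ! j) (ags ! b)"
    and alpha: "alpha G = m ^ q"
begin

lemma assignment_iff:
  "assignment G p \<longleftrightarrow> (\<forall>b < length ags. \<forall>i. p b = Some i \<longrightarrow> i < m) \<and>
    (\<forall>b < length ags. \<forall>b' < length ags. \<forall>i. p b = Some i \<longrightarrow> p b' = Some i \<longrightarrow> b = b')"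
proof -
  have "(\<forall>i. p b = Some i \<longrightarrow> p b' = Some i \<longrightarrow> b = b') \<longleftrightarrow> (p b \<noteq> None \<and> p b = p b' \<longrightarrow> b = b')" for b b'
    by auto
  then show ?thesis by (simp add: assignment_def agents items subset_iff Ball_def)
qed

lemma legal_iff:
  assumes "j < length views"
  shows "legal G j p \<longleftrightarrow> assignment G p \<and>
    (\<forall>b < length ags. \<forall>i. p b = Some i \<longrightarrow> i \<in> set (view_prefs m (views ! j) (ags ! b)))"
  using layer[OF assms] by (auto simp: legal_def agents subset_iff)

text \<open>An agent of the view accepts only its item, and no other agent accepts that item. An
  agent left without it could take it at nobody's expense.\<close>

lemma pareto_optimal_forced:
  assumes po: "pareto_optimal G j p" and j: "j < length views"
    and e: "(i, ags ! b) \<in> set (views ! j)" and b: "b < length ags"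
  shows "p b = Some i"
proof (rule ccontr)
  assume neq: "p b \<noteq> Some i"
  have vw: "views ! j \<in> set views" using j by simp
  have legal: "legal G j p" using po by (simp add: pareto_optimal_def)
  then have pref: "i' \<in> set (view_prefs m (views ! j) (ags ! b'))" if "p b' = Some i'" "b' < length ags" for i' b'
    using that legal_iff[OF j] by blast
  have "p b = None"
    using pref[of b] neq e b by (cases "p b") (auto simp: set_view_prefs)
  have free: "p b' \<noteq> Some i" if "b' < length ags" for b'
  proof
    assume p: "p b' = Some i"
    then have "ags ! b' = ags ! b" using pref[OF p that] e by (auto simp: set_view_prefs)
    then show False using that b ags p neq by (simp add: nth_eq_iff_index_eq)
  qed
  have i: "i \<in> set (view_prefs m (views ! j) (ags ! b))"
    unfolding set_view_prefs
    using view_elem[OF vw e] view_inj[OF vw _ e] by auto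
  let ?q = "p(b := Some i)"
  have "assignment G ?q"
    using legal free i unfolding legal_def assignment_iff by (auto simp: set_view_prefs)
  then have "legal G j ?q"
    using legal i unfolding legal_iff[OF j] by auto
  moreover have "p b' = ?q b' \<or> less_pref ((layers G ! j) b') (p b') (?q b')"
    "less_pref ((layers G ! j) b) (p b) (?q b)" for b'
    using \<open>p b = None\<close> i layer[OF j b] by auto
  ultimately show False
    using po b unfolding pareto_optimal_def agents by blast
qed

text \<open>All lists follow the same order of the items, which rules out cyclic exchanges; as every
  item is given away, no free item is left for an improvement either.\<close>

lemma pareto_optimalI:
  assumes j: "j < length views" and legal: "legal G j p"
    and total: "\<And>i. i < m \<Longrightarrow> \<exists>b < length ags. p b = Some i"
  shows "pareto_optimal G j p"
  unfolding pareto_optimal_def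
proof (intro conjI notI legal)
  assume "\<exists>q. legal G j q \<and>
          (\<forall>a \<in> agents G. p a = q a \<or> less_pref ((layers G ! j) a) (p a) (q a)) \<and>
          (\<exists>a \<in> agents G. less_pref ((layers G ! j) a) (p a) (q a))"
  then obtain q b where q: "legal G j q"
    "\<And>b. b < length ags \<Longrightarrow> p b = q b \<or> less_pref (view_prefs m (views ! j) (ags ! b)) (p b) (q b)"
    and b: "b < length ags" "less_pref (view_prefs m (views ! j) (ags ! b)) (p b) (q b)"
    using layer[OF j] by (auto simp: agents)
  have inj: "c = c'" if "q c = Some i" "q c' = Some i" "c < length ags" "c' < length ags" for c c' i
    using q(1) that by (auto simp: legal_def assignment_def agents)
  \<comment> \<open>No agent can be the first to improve, since all better items are taken by agents that keep them.\<close>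
  have keep: "q c = Some i" if "p c = Some i" "c < length ags" for c i
    using that
  proof (induction i arbitrary: c rule: less_induct)
    case (less i)
    show ?case
    proof (rule ccontr)
      assume "q c \<noteq> Some i"
      then have lp: "less_pref (view_prefs m (views ! j) (ags ! c)) (Some i) (q c)"
        using q(2)[OF less.prems(2)] less.prems(1) by auto
      then obtain z where z: "q c = Some z" by (cases "q c") auto
      then have "z < i" using lp less_pref_view_prefs by metis
      moreover have "z < m" using lp less_pref_elem z by (metis set_view_prefs)
      ultimately obtain c' where "c' < length ags" "p c' = Some z" "q c' = Some z"
        using total less.IH by blast
      then have "c' = c" using inj z less.prems(2) by blast
      then show False using \<open>p c' = Some z\<close> less.prems(1) \<open>z < i\<close> by simp
    qed
  qed
  obtain z where z: "q b = Some z" using b by (cases "q b") auto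
  then have "z < m" using b(2) less_pref_elem by (metis set_view_prefs)
  then obtain c where c: "c < length ags" "p c = Some z" using total by blast
  then have "b = c" using keep inj z b by blast
  then show False using b(2) z c less_pref_view_prefs by fastforce
qed

text \<open>Pigeonhole: in an optimal layer the view agrees with the assignment, so its tuple of
  items determines it. The \<open>m ^ q\<close> optimal layers therefore have different tuples, and
  there are only \<open>m ^ q\<close> tuples, so each one occurs.\<close>

lemma globally_optimal_labelling:
  assumes "globally_optimal G p" shows "\<exists>A. labelling m q views A"
proof -
  obtain J where J: "J \<subseteq> {..<length views}" "card J = m ^ q" "\<And>j. j \<in> J \<Longrightarrow> pareto_optimal G j p"
    and asg: "assignment G p"
    using assms by (auto simp: globally_optimal_def length_layers alpha)
  define P where "P a i \<longleftrightarrow> (\<exists>b < length ags. ags ! b = a \<and> p b = Some i)" for a i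
  have forced: "P a i" if "j \<in> J" "(i, a) \<in> set (views ! j)" for i a j
  proof -
    have "a \<in> set ags" using that J(1) view_elem[of "views ! j"] by auto
    then obtain b where "b < length ags" "ags ! b = a" by (auto simp: in_set_conv_nth)
    then show ?thesis
      using pareto_optimal_forced[OF J(3)[OF that(1)]] that J(1) unfolding P_def by blast
  qed
  have P_unique: "a = a'" if "P a i" "P a' i" for a a' i
    using that asg by (force simp: P_def assignment_def agents)
  \<comment> \<open>The holder of item \<open>i\<close>; it is evaluated only where a view in
    \<open>J\<close> guarantees that a holder exists.\<close>
  define A where "A i = (THE a. P a i)" for i
  have A: "A i = a" if "P a i" for a i
    unfolding A_def using that P_unique by blast
  have vw: "views ! j = map (\<lambda>i. (i, A i)) (map fst (views ! j))" if "j \<in> J" for j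
  proof -
    have "e = (fst e, A (fst e))" if "e \<in> set (views ! j)" for e
      using A[OF forced[OF \<open>j \<in> J\<close>, of "fst e" "snd e"]] that by simp
    then have "map id (views ! j) = map (\<lambda>e. (fst e, A (fst e))) (views ! j)"
      by (intro map_cong) auto
    then show ?thesis by (simp add: comp_def)
  qed
  let ?f = "\<lambda>j. map fst (views ! j)"
  have "inj_on ?f J"
  proof (rule inj_onI)
    fix j j' assume *: "j \<in> J" "j' \<in> J" "?f j = ?f j'"
    then have "views ! j = views ! j'" using vw by metis
    then show "j = j'" using * J(1) views by (metis lessThan_iff nth_eq_iff_index_eq subsetD)
  qed
  then have "card (?f ` J) = m ^ q" by (simp add: card_image J)
  moreover have "?f ` J \<subseteq> set (List.n_lists q [0..<m])"
  proof
    fix ts assume "ts \<in> ?f ` J"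
    then obtain j where j: "ts = ?f j" "views ! j \<in> set views" using J(1) by auto
    then show "ts \<in> set (List.n_lists q [0..<m])"
      using view_length[OF j(2)] view_elem[OF j(2)] by (auto simp: set_n_lists)
  qed
  ultimately have img: "?f ` J = set (List.n_lists q [0..<m])"
    using card_n_lists by (intro card_subset_eq) auto
  have "labelling m q views A"
    unfolding labelling_def
  proof
    fix ts assume "ts \<in> set (List.n_lists q [0..<m])"
    then have "ts \<in> ?f ` J" by (simp only: img)
    then obtain j where "j \<in> J" "ts = ?f j" by blast
    moreover have "views ! j \<in> set views" using \<open>j \<in> J\<close> J(1) by auto
    ultimately show "map (\<lambda>i. (i, A i)) ts \<in> set views"
      using vw[of j] by simp
  qed
  then show ?thesis by blast
qed

text \<open>The assignment is the inverse of the labelling. The bound on the number of views makes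
  \<open>alpha\<close> admissible for an instance.\<close>

lemma labelling_globally_optimal:
  assumes A: "labelling m q views A"
  shows "m ^ q \<le> length views" "\<exists>p. globally_optimal G p"
proof -
  let ?v = "\<lambda>ts. map (\<lambda>i. (i, A i)) ts"
  have view: "?v ts \<in> set views" if "length ts = q" "set ts \<subseteq> {..<m}" for ts
    using A that unfolding labelling_def by (auto simp: set_n_lists atLeast0LessThan)
  have A_inj: "(i = i') = (A i = A i')" if "i < m" "i' < m" for i i'
  proof -
    \<comment> \<open>Padding two slots to a full tuple turns \<open>view_inj\<close> into
      injectivity of \<open>A\<close>; this needs \<open>2 \<le> q\<close>.\<close>
    have "?v (i # i' # replicate (q - 2) i) \<in> set views"
      using that q by (intro view) auto
    from view_inj[OF this, of "(i, A i)" "(i', A i')"] show ?thesis by simp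
  qed
  have A_ags: "A i \<in> set ags" if "i < m" for i
  proof -
    have "?v (replicate q i) \<in> set views"
      using that by (intro view) auto
    from view_elem[OF this, of i "A i"] show ?thesis using q by simp
  qed
  define p where "p b = (if \<exists>i < m. A i = ags ! b then Some (THE i. i < m \<and> A i = ags ! b) else None)" for b
  have p: "p b = Some i \<longleftrightarrow> i < m \<and> A i = ags ! b" for b i
  proof -
    have "(THE i. i < m \<and> A i = ags ! b) = i" if "i < m" "A i = ags ! b" for i
      using that A_inj by (intro the_equality) auto
    then show ?thesis unfolding p_def by auto
  qed
  define J where "J = {j. j < length views \<and> (\<exists>ts \<in> set (List.n_lists q [0..<m]). views ! j = ?v ts)}"
  let ?f = "\<lambda>j. map fst (views ! j)"
  have "inj_on ?f J"
  proof (rule inj_onI)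
    fix j j' assume *: "j \<in> J" "j' \<in> J" "?f j = ?f j'"
    then have "views ! j = views ! j'" by (auto simp: J_def comp_def)
    then show "j = j'" using * views by (auto simp: J_def nth_eq_iff_index_eq)
  qed
  moreover have "?f ` J = set (List.n_lists q [0..<m])"
  proof
    show "set (List.n_lists q [0..<m]) \<subseteq> ?f ` J"
    proof
      fix ts assume ts: "ts \<in> set (List.n_lists q [0..<m])"
      then have "?v ts \<in> set views" using A by (simp add: labelling_def)
      then obtain j where "j < length views" "views ! j = ?v ts" by (auto simp: in_set_conv_nth)
      then have "j \<in> J" "?f j = ts" using ts by (auto simp: J_def comp_def)
      then show "ts \<in> ?f ` J" by blast
    qed
  qed (auto simp: J_def comp_def)
  ultimately have card: "card J = m ^ q"
    using card_n_lists by (metis card_image)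
  have J: "J \<subseteq> {..<length views}" by (auto simp: J_def)
  show "m ^ q \<le> length views" using card_mono[OF _ J] card by simp
  have asg: "assignment G p"
    unfolding assignment_iff p using ags by (metis nth_eq_iff_index_eq)
  have "pareto_optimal G j p" if jJ: "j \<in> J" for j
  proof (rule pareto_optimalI)
    show j: "j < length views" using jJ by (simp add: J_def)
    obtain ts where ts: "set ts \<subseteq> {..<m}" "views ! j = ?v ts"
      using jJ by (auto simp: J_def set_n_lists atLeast0LessThan)
    show "legal G j p"
      unfolding legal_iff[OF j] using asg ts A_inj by (auto simp: p set_view_prefs)
    show "\<exists>b < length ags. p b = Some i" if "i < m" for i
      using A_ags[OF that] that unfolding p in_set_conv_nth by metis
  qed
  then show "\<exists>p. globally_optimal G p"
    unfolding globally_optimal_def using asg J card alpha length_layers by metis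
qed

end

text \<open>An encoding fixes preference lists only for actual agents, so \<open>G\<close> is
  determined on these alone and the layers cannot be compared as functions.\<close>

lemma enc_goa_eq_view_code:
  "enc_goa G = enc (view_code ags m q views) \<longleftrightarrow> card (agents G) = length ags \<and> card (items G) = m \<and>
     length (layers G) = length views \<and>
     (\<forall>j < length views. \<forall>b < length ags. (layers G ! j) b = view_prefs m (views ! j) (ags ! b)) \<and>
     alpha G = m ^ q"
proof -
  have [simp]: "(enc :: nat \<Rightarrow> data) = enc_nat" by (simp add: fun_eq_iff enc_nat_def)
  have [simp]: "(enc :: 'z :: enc list \<Rightarrow> data) = enc_list enc" by (simp add: fun_eq_iff enc_list_def)
  have "enc_goa G = enc (view_code ags m q views) \<longleftrightarrow> card (agents G) = length ags \<and> card (items G) = m \<and>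
    list_all2 (\<lambda>P vw. list_all2 (\<lambda>b a. list_all2 (=) (P b) (view_prefs m vw a)) [0..<length ags] ags)
      (layers G) views \<and>
    alpha G = m ^ q"
    by (auto simp: enc_goa_def view_code_def enc_list_eq_iff list.rel_map)
  then show ?thesis
    by (simp add: list_all2_conv_all_nth[of _ "layers G"] list_all2_conv_all_nth[of _ "[0..<length ags]"] list.rel_eq cong: conj_cong)
qed

lemma view_code_iff:
  "(enc (view_code ags m q views), m + m ^ q) \<in> globally_optimal_assignment \<longleftrightarrow> (\<exists>A. labelling m q views A)"
proof
  assume "(enc (view_code ags m q views), m + m ^ q) \<in> globally_optimal_assignment"
  then obtain G :: "(nat, nat) goa" and p where G: "enc_goa G = enc (view_code ags m q views)"
    "agents G = {..<card (agents G)}" "items G = {..<card (items G)}" "globally_optimal G p"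
    unfolding globally_optimal_assignment_def by auto
  show "\<exists>A. labelling m q views A"
    by (rule globally_optimal_labelling[of G p]) (use G enc_goa_eq_view_code[of G] in auto)
next
  assume "\<exists>A. labelling m q views A"
  then obtain A where A: "labelling m q views A" by blast
  define G :: "(nat, nat) goa" where "G = \<lparr>agents = {..<length ags}, items = {..<m},
    layers = map (\<lambda>vw b. view_prefs m vw (ags ! b)) views, alpha = m ^ q\<rparr>"
  have G: "agents G = {..<length ags}" "items G = {..<m}" "length (layers G) = length views"
    "\<And>j b. j < length views \<Longrightarrow> b < length ags \<Longrightarrow> (layers G ! j) b = view_prefs m (views ! j) (ags ! b)"
    "alpha G = m ^ q"
    by (simp_all add: G_def)
  note opt = labelling_globally_optimal[OF G A]
  have "goa_instance G"
    using opt(1) m by (auto simp: goa_instance_def G_def view_prefs_def)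
  moreover have "enc_goa G = enc (view_code ags m q views)"
    unfolding enc_goa_eq_view_code using G by simp
  ultimately show "(enc (view_code ags m q views), m + m ^ q) \<in> globally_optimal_assignment"
    unfolding globally_optimal_assignment_def using opt(2) G by (intro CollectI exI[of _ G]) auto
qed

end

section \<open>Weighted satisfiability as a labelling problem\<close>

text \<open>
  The slots are \<open>0, \<dots>, k\<close>. An agent \<open>u # v # g\<close> in slot \<open>t\<close> says that nodes \<open>u - 1\<close> and
  \<open>v - 1\<close> are the \<open>t\<close>-th and the next true input in increasing order (\<open>u = 0\<close> and
  \<open>v = length C + 1\<close> are sentinels), and that \<open>g\<close> is the guess for the large gates.
\<close>

definition gap_agents :: "nat \<Rightarrow> circuit \<Rightarrow> nat list list" where
  "gap_agents d C = List.n_lists (guess_length d + 2) [0..<length C + 2]"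

definition slot_ok :: "circuit \<Rightarrow> nat \<Rightarrow> nat \<times> nat list \<Rightarrow> bool" where
  "slot_ok C k e \<longleftrightarrow> nthd 0 (snd e) 0 < nthd 0 (snd e) 1 \<and>
     (fst e = 0 \<longrightarrow> nthd 0 (snd e) 0 = 0) \<and> (fst e = k \<longrightarrow> nthd 0 (snd e) 1 = length C + 1) \<and>
     (nthd 0 (snd e) 0 = 0 \<or> preds (nthd Input C (nthd 0 (snd e) 0 - 1)) = [])"

text \<open>The first conjunct provides \<open>view_inj\<close>; the other two make all slots share
  one guess and make neighbouring gaps meet.\<close>

definition compatible :: "nat \<times> nat list \<Rightarrow> nat \<times> nat list \<Rightarrow> bool" where
  "compatible e e' \<longleftrightarrow> (fst e = fst e') = (snd e = snd e') \<and> drop 2 (snd e) = drop 2 (snd e') \<and>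
     (fst e' = Suc (fst e) \<longrightarrow> nthd 0 (snd e') 0 = nthd 0 (snd e) 1)"

text \<open>Compatible agents share their guess, so it can be read off the first entry; views have
  \<open>2 ^ d\<close> entries and hence a first one.\<close>

definition view_ok :: "nat \<Rightarrow> circuit \<Rightarrow> (nat \<times> nat list) list \<Rightarrow> bool" where
  "view_ok d C vw \<longleftrightarrow> (\<forall>e \<in> set vw. \<forall>e' \<in> set vw. compatible e e') \<and>
     \<not> refuted d C (map snd vw) (drop 2 (snd (nthd (0, []) vw 0))) True (length C - 1)"

definition gap_views :: "nat \<Rightarrow> circuit \<Rightarrow> nat \<Rightarrow> (nat \<times> nat list) list list" where
  "gap_views d C k = filter (view_ok d C) (List.n_lists (2 ^ d)
     (filter (slot_ok C k) (List.product [0..<Suc k] (gap_agents d C))))"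

lemma ex_interval:
  fixes y :: "nat \<Rightarrow> nat"
  assumes "y 0 \<le> x" "x < y (Suc k)"
  shows "\<exists>t \<le> k. y t \<le> x \<and> x < y (Suc t)"
  using assms
proof (induction k)
  case (Suc k)
  then show ?case by (cases "x < y (Suc k)") (auto intro: le_SucI)
qed auto

lemma chain_mono:
  fixes y :: "nat \<Rightarrow> nat"
  assumes "\<And>t. t \<le> k \<Longrightarrow> y t < y (Suc t)" "s < t" "t \<le> Suc k"
  shows "y s < y t"
  using assms(2,3)
proof (induction t)
  case (Suc t)
  then show ?case using assms(1)[of t] by (cases "s = t") (auto simp: less_Suc_eq)
qed simp

section \<open>Chains of gaps decide the inputs\<close>

context
  fixes C :: circuit and y :: "nat \<Rightarrow> nat" and k :: nat and S :: "nat set" and V :: "nat list list"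
  assumes chain: "\<And>t. t \<le> k \<Longrightarrow> y t < y (Suc t)"
    and y_0: "y 0 = 0" and y_last: "y (Suc k) = length C + 1"
    and S: "S = (\<lambda>t. y t - 1) ` {1..k}"
    and V: "\<And>a. a \<in> set V \<Longrightarrow> \<exists>t \<le> k. nthd 0 a 0 = y t \<and> nthd 0 a 1 = y (Suc t)"
      "\<And>t. t \<le> k \<Longrightarrow> \<exists>a \<in> set V. nthd 0 a 0 = y t \<and> nthd 0 a 1 = y (Suc t)"
begin

lemma y_pos: "1 \<le> t \<Longrightarrow> t \<le> k \<Longrightarrow> 0 < y t"
  using chain_mono[of k y 0 t] chain y_0 by simp

lemma card_gap_set: "card S = k"
proof -
  have "inj_on (\<lambda>t. y t - 1) {1..k}"
  proof (rule inj_onI)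
    fix s t assume *: "s \<in> {1..k}" "t \<in> {1..k}" "y s - 1 = y t - 1"
    then have "y s = y t" using y_pos[of s] y_pos[of t] by auto
    then show "s = t"
      using chain_mono[of k y s t] chain_mono[of k y t s] chain * by (cases s t rule: linorder_cases) auto
  qed
  then show ?thesis unfolding S by (simp add: card_image)
qed

text \<open>The intervals from \<open>y t\<close> up to, but excluding, \<open>y (Suc t)\<close>
  partition the numbers up to \<open>length C\<close>. So one gap covers \<open>i + 1\<close>, and
  \<open>i\<close> is in \<open>S\<close> exactly when this gap starts there.\<close>

lemma gap_decides:
  assumes "i < length C" shows "lit_refuted V pol i \<longleftrightarrow> (i \<in> S) \<noteq> pol"
proof -
  obtain t where t: "t \<le> k" "y t \<le> i + 1" "i + 1 < y (Suc t)"
    using ex_interval[of y "i + 1" k] y_0 y_last assms by auto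
  have unique: "s = t" if "s \<le> k" "y s \<le> i + 1" "i + 1 < y (Suc s)" for s
  proof (rule ccontr)
    have less: "y (Suc a) \<le> y b" if "a < b" "b \<le> k" for a b
    proof (cases "Suc a = b")
      case False
      then show ?thesis
        using that chain_mono[of k y "Suc a" b, OF chain] by (simp add: less_imp_le Suc_lessI)
    qed simp
    assume "s \<noteq> t"
    then consider "s < t" | "t < s" by linarith
    then show False
    proof cases
      case 1
      then show False using less[of s t] that t by linarith
    next
      case 2
      then show False using less[of t s] that t by linarith
    qed
  qed
  have "i \<in> S \<longleftrightarrow> y t = i + 1"
  proof
    assume "i \<in> S"
    then obtain s where s: "1 \<le> s" "s \<le> k" "i = y s - 1" unfolding S by auto
    then have "y s = i + 1" using y_pos[of s] by auto
    moreover have "s = t" using unique[of s] s(2) chain[OF s(2)] \<open>y s = i + 1\<close> by simp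
    ultimately show "y t = i + 1" by simp
  next
    assume yt: "y t = i + 1"
    then have "1 \<le> t" using y_0 by (cases t) auto
    then show "i \<in> S" unfolding S using yt t(1) by (intro image_eqI[of _ _ t]) auto
  qed
  moreover have "lit_refuted V pol i \<longleftrightarrow> (y t = i + 1) \<noteq> pol"
  proof
    assume "lit_refuted V pol i"
    then obtain a where a: "a \<in> set V" "nthd 0 a 0 \<le> i + 1" "i + 1 < nthd 0 a 1"
        "(nthd 0 a 0 = i + 1) \<noteq> pol"
      unfolding lit_refuted_def by blast
    from V(1)[OF a(1)] obtain s where s: "s \<le> k" "nthd 0 a 0 = y s" "nthd 0 a 1 = y (Suc s)" by blast
    then have "y s \<le> i + 1" "i + 1 < y (Suc s)" using a by simp_all
    then have "s = t" using unique s(1) by blast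
    then show "(y t = i + 1) \<noteq> pol" using a s by simp
  next
    assume "(y t = i + 1) \<noteq> pol"
    moreover obtain a where "a \<in> set V" "nthd 0 a 0 = y t" "nthd 0 a 1 = y (Suc t)"
      using V(2) t(1) by blast
    ultimately show "lit_refuted V pol i"
      unfolding lit_refuted_def using t by metis
  qed
  ultimately show ?thesis by simp
qed

end

lemma input_node_iff:
  "wf_circuit C \<Longrightarrow> i < length C \<Longrightarrow> i \<in> input_nodes C \<longleftrightarrow> preds (nthd Input C i) = []"
  using preds_Nil_iff[OF wf_circuit_gate(1)] by (simp add: input_nodes_def)

section \<open>Satisfying inputs correspond to labellings\<close>

context
  fixes C :: circuit and d k :: nat
  assumes wf: "wf_circuit C" and sh: "shallow 1 d C (output_node C)" and d: "1 \<le> d"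
begin

lemma two_le_pow: "2 \<le> (2 :: nat) ^ d"
  using power_increasing[OF d, of "2 :: nat"] by simp

lemma set_gap_views:
  "vw \<in> set (gap_views d C k) \<longleftrightarrow> length vw = 2 ^ d \<and>
     (\<forall>e \<in> set vw. fst e < Suc k \<and> snd e \<in> set (gap_agents d C) \<and> slot_ok C k e) \<and> view_ok d C vw"
  by (auto simp: gap_views_def set_n_lists)

lemma satisfiable_labelling:
  assumes "weighted_satisfiable C k"
  shows "\<exists>A. labelling (Suc k) (2 ^ d) (gap_views d C k) A"
proof -
  obtain S where S: "S \<subseteq> input_nodes C" "card S = k" "node_value C S (output_node C)"
    using assms by (auto simp: weighted_satisfiable_def)
  define xs where "xs = sorted_list_of_set S"
  have finS: "finite S" using S(1) by (rule finite_subset) (simp add: input_nodes_def)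
  have xs: "sorted_wrt (<) xs" "length xs = k" "set xs = S"
    using S(2) finS by (simp_all add: xs_def)
  \<comment> \<open>Endpoints are shifted by one, so that the left sentinel 0 differs from node
    0.\<close>
  define y where "y t = (if t = 0 then 0 else if t \<le> k then Suc (xs ! (t - 1)) else length C + 1)" for t
  have xs_less: "xs ! t < length C" "xs ! t \<in> S" if "t < k" for t
  proof -
    show "xs ! t \<in> S" using xs that nth_mem by metis
    then show "xs ! t < length C" using S(1) by (auto simp: input_nodes_def)
  qed
  have y_0: "y 0 = 0" and y_last: "y (Suc k) = length C + 1" by (simp_all add: y_def)
  have chain: "y t < y (Suc t)" if "t \<le> k" for t
    using that xs_less(1)[of "t - 1"] sorted_wrt_nth_less[OF xs(1), of "t - 1" t] xs(2)
    by (cases t) (auto simp: y_def)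
  have S_y: "S = (\<lambda>t. y t - 1) ` {1..k}"
  proof -
    have "S = (\<lambda>t. xs ! t) ` {0..<k}" using xs(2,3) by (auto simp: in_set_conv_nth)
    also have "\<dots> = (\<lambda>t. y t - 1) ` Suc ` {0..<k}" unfolding image_image by (auto simp: y_def)
    finally show ?thesis by (simp add: atLeastLessThanSuc_atLeastAtMost)
  qed
  have y_le: "y t \<le> length C + 1" for t
    using xs_less(1)[of "t - 1"] by (cases t) (auto simp: y_def Suc_le_eq less_imp_le)
  define a where "a g t = y t # y (Suc t) # g" for g t
  have a: "nthd 0 (a g t) 0 = y t" "nthd 0 (a g t) 1 = y (Suc t)"
    "nthd 0 (a g t) (Suc 0) = y (Suc t)" "drop 2 (a g t) = g" for g t
    by (simp_all add: a_def nthd_def)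
  let ?V = "\<lambda>g. map (a g) [0..<Suc k]"
  have dec: "lit_refuted (?V g) pol i \<longleftrightarrow> (i \<in> S) \<noteq> pol" if "i \<in> input_nodes C" for g pol i
    by (rule gap_decides[OF chain y_0 y_last S_y])
       (use that a in \<open>auto simp: less_Suc_eq_le input_nodes_def simp del: upt_Suc\<close>)
  \<comment> \<open>The agents contain the guess, yet the guess is chosen for their view. The circle
    is broken by choosing it for \<open>?V []\<close>, as literals depend only on the first two
    entries of an agent.\<close>
  have "\<exists>g. length g = guess_length d \<and> set g \<subseteq> {..<length C} \<and>
    (\<forall>h. \<not> refuted d C (?V []) (g @ h) True (output_node C))"
    by (rule not_refuted_complete[OF wf dec sh wf_output[OF wf]]) (use S(3) in auto)
  then obtain g where g: "length g = guess_length d" "set g \<subseteq> {..<length C}"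
    and nr0: "\<And>h. \<not> refuted d C (?V []) (g @ h) True (output_node C)" by blast
  have lit: "lit_refuted (map (a h) ts) pol i \<longleftrightarrow> lit_refuted (map (a []) ts) pol i" for h ts pol i
    by (simp add: lit_refuted_def a)
  have nr: "\<not> refuted d C (map (a g) ts) g True (output_node C)" if "set ts \<subseteq> {..<Suc k}" for ts
  proof
    assume "refuted d C (map (a g) ts) g True (output_node C)"
    moreover have "lit_refuted (?V []) pol i" if "lit_refuted (map (a g) ts) pol i" for pol i
      using lit[THEN iffD1, OF that]
      by (rule lit_refuted_mono) (use \<open>set ts \<subseteq> {..<Suc k}\<close> in \<open>auto simp del: upt_Suc\<close>)
    ultimately have "refuted d C (?V []) g True (output_node C)"
      using refuted_mono by blast
    then show False using nr0[of "[]"] by simp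
  qed
  have a_inj: "(t = t') = (a g t = a g t')" if "t < Suc k" "t' < Suc k" for t t'
  proof
    assume "a g t = a g t'"
    then have "y t = y t'" by (simp add: a_def)
    then show "t = t'"
      using that chain_mono[of k y t t', OF chain] chain_mono[of k y t' t, OF chain]
      by (cases t t' rule: linorder_cases) auto
  qed simp
  have agent: "a g t \<in> set (gap_agents d C)" if "t < Suc k" for t
    using y_le[of t] y_le[of "Suc t"] g
    by (fastforce simp: gap_agents_def set_n_lists a_def less_Suc_eq_le)
  have slot: "slot_ok C k (t, a g t)" if "t < Suc k" for t
  proof -
    have "preds (nthd Input C (y t - 1)) = []" if "t \<noteq> 0"
    proof -
      have "y t - 1 \<in> S" using that \<open>t < Suc k\<close> S_y by auto
      then show ?thesis using S(1) input_node_iff[OF wf] by (auto simp: input_nodes_def)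
    qed
    then show ?thesis
      unfolding slot_ok_def using chain[of t] that y_0 y_last
      by (auto simp: a less_Suc_eq_le)
  qed
  have "labelling (Suc k) (2 ^ d) (gap_views d C k) (a g)"
    unfolding labelling_def
  proof
    fix ts assume "ts \<in> set (List.n_lists (2 ^ d) [0..<Suc k])"
    then have ts: "length ts = 2 ^ d" "set ts \<subseteq> {..<Suc k}"
      by (auto simp: set_n_lists simp del: upt_Suc)
    have ts0: "0 < length ts" using ts(1) by simp
    have "view_ok d C (map (\<lambda>i. (i, a g i)) ts)"
      unfolding view_ok_def
    proof (intro conjI)
      show "\<not> refuted d C (map snd (map (\<lambda>i. (i, a g i)) ts))
          (drop 2 (snd (nthd (0, []) (map (\<lambda>i. (i, a g i)) ts) 0))) True (length C - 1)"
        using nr[OF ts(2)] ts0 by (simp add: comp_def a output_node_def)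
      show "\<forall>e \<in> set (map (\<lambda>i. (i, a g i)) ts). \<forall>e' \<in> set (map (\<lambda>i. (i, a g i)) ts). compatible e e'"
        using ts(2) a_inj by (auto simp: compatible_def a)
    qed
    then show "map (\<lambda>i. (i, a g i)) ts \<in> set (gap_views d C k)"
      unfolding set_gap_views using ts agent slot by auto
  qed
  then show ?thesis by blast
qed

lemma labelling_satisfiable:
  assumes "labelling (Suc k) (2 ^ d) (gap_views d C k) A"
  shows "weighted_satisfiable C k"
proof -
  let ?v = "map (\<lambda>i. (i, A i))"
  have view: "?v ts \<in> set (gap_views d C k)" if "length ts = 2 ^ d" "set ts \<subseteq> {..<Suc k}" for ts
  proof -
    have "ts \<in> set (List.n_lists (2 ^ d) [0..<Suc k])"
      using that by (auto simp: set_n_lists simp del: upt_Suc)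
    then show ?thesis by (rule bspec[OF assms[unfolded labelling_def]])
  qed
  have compat: "compatible (t, A t) (t', A t')" and slot: "A t \<in> set (gap_agents d C)" "slot_ok C k (t, A t)"
    if "t \<le> k" "t' \<le> k" for t t'
  proof -
    \<comment> \<open>A tuple that starts with the two slots in question and is padded with slot 0;
      it yields all unary and pairwise conditions.\<close>
    have "?v (t # t' # replicate (2 ^ d - 2) 0) \<in> set (gap_views d C k)"
      using that two_le_pow by (intro view) auto
    then show "compatible (t, A t) (t', A t')" "A t \<in> set (gap_agents d C)" "slot_ok C k (t, A t)"
      unfolding set_gap_views view_ok_def by simp_all
  qed
  define y where "y t = (if t \<le> k then nthd 0 (A t) 0 else length C + 1)" for t
  define g where "g = drop 2 (A 0)"
  have g: "drop 2 (A t) = g" if "t \<le> k" for t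
    using compat[OF that, of 0] by (simp add: g_def compatible_def)
  \<comment> \<open>For \<open>t < k\<close> the right end is the left end of the next slot by
    compatibility; for \<open>t = k\<close> it is the right sentinel.\<close>
  have A_y: "nthd 0 (A t) 0 = y t" "nthd 0 (A t) 1 = y (Suc t)" if "t \<le> k" for t
    using that slot[OF that that] compat[OF that, of "Suc t"]
    by (auto simp: y_def slot_ok_def compatible_def not_less_eq_eq)
  have chain: "y t < y (Suc t)" if "t \<le> k" for t
    using slot(2)[OF that that] A_y[OF that] by (simp add: slot_ok_def)
  have y_0: "y 0 = 0" using slot(2)[of 0 0] A_y(1)[of 0] by (simp add: slot_ok_def)
  have y_last: "y (Suc k) = length C + 1" by (simp add: y_def)
  define S where "S = (\<lambda>t. y t - 1) ` {1..k}"
  define V where "V = map A [0..<Suc k]"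
  have V: "\<And>a. a \<in> set V \<Longrightarrow> \<exists>t \<le> k. nthd 0 a 0 = y t \<and> nthd 0 a 1 = y (Suc t)"
    "\<And>t. t \<le> k \<Longrightarrow> \<exists>a \<in> set V. nthd 0 a 0 = y t \<and> nthd 0 a 1 = y (Suc t)"
    using A_y by (auto simp: V_def less_Suc_eq_le simp del: upt_Suc)
  note gap = chain y_0 y_last S_def V
  have S_inputs: "S \<subseteq> input_nodes C"
  proof
    fix i assume "i \<in> S"
    then obtain t where t: "1 \<le> t" "t \<le> k" "i = y t - 1" by (auto simp: S_def)
    have "0 < y t" using y_pos[OF gap] t by blast
    moreover have "y t < length C + 1" using chain_mono[of k y t "Suc k", OF chain] t y_last by simp
    ultimately have "i < length C" "nthd 0 (A t) 0 \<noteq> 0" using t A_y(1)[OF t(2)] by auto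
    then show "i \<in> input_nodes C"
      using slot(2)[OF t(2) t(2)] A_y(1)[OF t(2)] t(3) input_node_iff[OF wf] by (auto simp: slot_ok_def)
  qed
  have nr: "\<not> refuted d C V g True (output_node C)"
  proof
    assume "refuted d C V g True (output_node C)"
    from refuted_compact[OF this] obtain W where
      W: "set W \<subseteq> set V" "length W \<le> 2 ^ d" "refuted d C W g True (output_node C)" by blast
    have "\<forall>b \<in> set W. \<exists>t < Suc k. b = A t"
      using W(1) by (fastforce simp: V_def simp del: upt_Suc)
    then obtain slot_of where slot_of: "\<And>b. b \<in> set W \<Longrightarrow> slot_of b < Suc k \<and> b = A (slot_of b)"
      by metis
    define us where "us = map slot_of W"
    have us: "set us \<subseteq> {..<Suc k}" "W = map A us"
      using slot_of by (auto simp: us_def intro!: map_idI[symmetric])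
    \<comment> \<open>A refutation from the whole chain would already come from at most
      \<open>2 ^ d\<close> slots. Padded with slot 0 they form one tuple, whose view is in
      \<open>gap_views\<close> and hence not refuted.\<close>
    define ts where "ts = us @ replicate (2 ^ d - length us) 0"
    have ts: "length ts = 2 ^ d" "set ts \<subseteq> {..<Suc k}" using us W(2) by (auto simp: ts_def)
    have ts0: "0 < length ts" using ts(1) by simp
    then have "ts ! 0 \<in> set ts" by (rule nth_mem)
    then have "ts ! 0 < Suc k" using ts(2) by auto
    have "refuted d C (map A ts) g True (output_node C)"
      by (rule refuted_mono[OF _ W(3)]) (auto elim!: lit_refuted_mono simp: us ts_def)
    then have "\<not> view_ok d C (?v ts)"
      using ts0 \<open>ts ! 0 < Suc k\<close> g[of "ts ! 0"] by (simp add: view_ok_def comp_def output_node_def)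
    then show False using view[OF ts] by (simp add: set_gap_views)
  qed
  have "node_value C S (output_node C) = True"
    using not_refuted_sound[OF wf _ sh wf_output[OF wf] nr, of S] gap_decides[OF gap]
    by (auto simp: input_nodes_def)
  then show ?thesis
    unfolding weighted_satisfiable_def using S_inputs card_gap_set[OF gap] by blast
qed

end

section \<open>The reduction runs in polynomial time\<close>

text \<open>Programs see only trees, so a value may be reread in another type with the same encoding
  at no cost.\<close>

lemma ptime_enc_cong: "ptime f \<Longrightarrow> (\<And>x. enc (f x) = enc (g x)) \<Longrightarrow> ptime g"
  unfolding ptime_def by simp

lemma ptime_enc: "ptime f \<Longrightarrow> ptime (\<lambda>x. enc (f x))"
  by (erule ptime_enc_cong) (simp add: enc_data_def)

lemma ptime_power:
  assumes "ptime f" shows "ptime (\<lambda>x. (f x :: nat) ^ n)"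
proof -
  have "ptime (\<lambda>x. length (List.n_lists n [0..<f x]))"
    by (intro ptime_length ptime_n_lists ptime_upt assms)
  then show ?thesis by (simp add: length_n_lists)
qed

lemma ptime_app5:
  assumes "ptime (\<lambda>z. F (fst z) (fst (snd z)) (fst (snd (snd z))) (fst (snd (snd (snd z))))
      (snd (snd (snd (snd z)))))"
    "ptime A" "ptime B" "ptime C" "ptime D" "ptime E"
  shows "ptime (\<lambda>x. F (A x) (B x) (C x) (D x) (E x))"
  using ptime_comp[OF assms(1), of "\<lambda>x. (A x, B x, C x, D x, E x)"]
  by (simp add: ptime_Pair assms)

lemmas ptime_basic = ptime_const ptime_id ptime_Pair ptime_fst ptime_snd ptime_If ptime_not ptime_conj ptime_disj
  ptime_imp ptime_iff ptime_tl ptime_null ptime_length ptime_Suc ptime_plus ptime_minus ptime_le ptime_less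
  ptime_eq_nat ptime_eq_nat_list ptime_upt ptime_nthd ptime_drop ptime_distinct_nat ptime_ex ptime_all
  ptime_filter ptime_map ptime_product ptime_n_lists ptime_power

subsection \<open>Reading circuits\<close>

text \<open>Every tree is a list of trees, namely the left subtrees along its right spine. So
  arbitrary, possibly malformed, inputs can be inspected with the list functions.\<close>

definition components :: "data \<Rightarrow> data list" where
  "components x = (SOME xs. enc xs = x)"

lemma ex_enc_data_list: "\<exists>xs :: data list. enc xs = x"
proof (induction x)
  case Lf
  show ?case by (rule exI[of _ "[]"]) simp
next
  case (Br x y)
  then obtain ys :: "data list" where "enc ys = y" by blast
  then show ?case by (intro exI[of _ "x # ys"]) (simp add: enc_data_def)
qed

lemma enc_components [simp]: "enc (components x) = x"
  unfolding components_def using ex_enc_data_list by (rule someI_ex)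

lemma components_simps [simp]: "components Lf = []" "components (Br x y) = x # components y"
proof -
  have inj: "xs = ys" if "enc xs = enc ys" for xs ys :: "data list"
    using that by (simp add: enc_list_def enc_list_eq_iff enc_data_def list.rel_eq)
  show "components Lf = []" by (rule inj) simp
  show "components (Br x y) = x # components y" by (rule inj) (simp add: enc_data_def)
qed

lemma ptime_components: "ptime f \<Longrightarrow> ptime (\<lambda>x. components (f x))"
  by (erule ptime_enc_cong) (simp add: enc_data_def)

lemma ptime_left: "ptime f \<Longrightarrow> ptime (\<lambda>x. left (f x))"
  by (rule ptime_expr_comp[of f "Left (Var 0)" left]) (auto simp: enc_data_def)

lemma ptime_right: "ptime f \<Longrightarrow> ptime (\<lambda>x. right (f x))"
  by (rule ptime_expr_comp[of f "Right (Var 0)" right]) (auto simp: enc_data_def)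

definition is_number :: "data \<Rightarrow> bool" where
  "is_number x \<longleftrightarrow> (\<forall>y \<in> set (components x). components y = [])"

lemma components_Nil_iff: "components y = [] \<longleftrightarrow> y = Lf"
  by (cases y) auto

lemma is_number_iff: "is_number x \<longleftrightarrow> (\<exists>n. x = enc_nat n)"
proof (induction x)
  case Lf
  show ?case by (auto simp: is_number_def intro: exI[of _ 0])
next
  case (Br x y)
  have "(\<exists>n. Br x y = enc_nat n) \<longleftrightarrow> x = Lf \<and> (\<exists>n. y = enc_nat n)"
  proof
    assume "\<exists>n. Br x y = enc_nat n"
    then obtain n where "Br x y = enc_nat n" by blast
    then show "x = Lf \<and> (\<exists>n. y = enc_nat n)" by (cases n) auto
  next
    assume "x = Lf \<and> (\<exists>n. y = enc_nat n)"
    then show "\<exists>n. Br x y = enc_nat n" by (metis enc_nat.simps(2))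
  qed
  then show ?case using Br by (simp add: is_number_def components_Nil_iff)
qed

lemma components_enc_nat: "length (components (enc_nat n)) = n"
  by (induction n) auto

definition is_gate :: "data \<Rightarrow> bool" where
  "is_gate x \<longleftrightarrow> components x \<noteq> [] \<and> is_number (left x) \<and>
     (length (components (left x)) = 0 \<and> components (right x) = [] \<or>
      length (components (left x)) = 1 \<and> is_number (right x) \<or>
      (length (components (left x)) = 2 \<or> length (components (left x)) = 3) \<and>
        (\<forall>y \<in> set (components (right x)). is_number y))"

definition is_circuit :: "data \<Rightarrow> bool" where
  "is_circuit x \<longleftrightarrow> (\<forall>y \<in> set (components x). is_gate y)"

lemma enc_list_iff:
  assumes "\<And>x. P x \<longleftrightarrow> (\<exists>y. x = f y)"
  shows "(\<forall>x \<in> set (components d). P x) \<longleftrightarrow> (\<exists>ys. d = enc_list f ys)"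
proof (induction d)
  case Lf
  show ?case by (auto intro: exI[of _ "[]"])
next
  case (Br x y)
  have "(\<exists>ys. Br x y = enc_list f ys) \<longleftrightarrow> (\<exists>z. x = f z) \<and> (\<exists>ys. y = enc_list f ys)"
  proof
    assume "\<exists>ys. Br x y = enc_list f ys"
    then obtain ys where "Br x y = enc_list f ys" by blast
    then show "(\<exists>z. x = f z) \<and> (\<exists>ys. y = enc_list f ys)" by (cases ys) auto
  next
    assume "(\<exists>z. x = f z) \<and> (\<exists>ys. y = enc_list f ys)"
    then show "\<exists>ys. Br x y = enc_list f ys" by (metis enc_list.simps(2))
  qed
  then show ?case using Br assms by simp
qed

lemma is_gate_iff: "is_gate x \<longleftrightarrow> (\<exists>g. x = enc_gate g)"
proof
  assume x: "is_gate x"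
  then obtain y z where yz: "x = Br y z" by (cases x) (auto simp: is_gate_def)
  obtain n where n: "y = enc_nat n" using x yz by (auto simp: is_gate_def is_number_iff)
  consider "n = 0" "z = Lf" | "n = 1" "is_number z"
    | "n = 2" "\<forall>y \<in> set (components z). is_number y" | "n = 3" "\<forall>y \<in> set (components z). is_number y"
    using x yz n by (auto simp: is_gate_def components_enc_nat components_Nil_iff)
  then show "\<exists>g. x = enc_gate g"
  proof cases
    case 1
    then show ?thesis using yz n by (intro exI[of _ Input]) simp
  next
    case 2
    then obtain j where "z = enc_nat j" by (auto simp: is_number_iff)
    then show ?thesis using 2 yz n by (intro exI[of _ "Neg j"]) simp
  next
    case 3
    then obtain js where "z = enc_list enc_nat js" using enc_list_iff[OF is_number_iff] by blast
    then show ?thesis using 3 yz n by (intro exI[of _ "Conj js"]) simp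
  next
    case 4
    then obtain js where "z = enc_list enc_nat js" using enc_list_iff[OF is_number_iff] by blast
    then show ?thesis using 4 yz n by (intro exI[of _ "Disj js"]) simp
  qed
next
  assume "\<exists>g. x = enc_gate g"
  then obtain g where g: "x = enc_gate g" by blast
  have *: "\<forall>y \<in> set (components (enc_list enc_nat js)). is_number y" for js
    using enc_list_iff[OF is_number_iff] by blast
  have num: "is_number (enc_nat n)" for n by (auto simp: is_number_iff)
  have t: "enc_nat 0 = Lf" "length (components (enc_nat 1)) = 1"
    "length (components (enc_nat 2)) = 2" "length (components (enc_nat 3)) = 3"
    by (simp_all add: components_enc_nat del: One_nat_def)
  show "is_gate x"
    using * num num[of 0] t unfolding g is_gate_def by (cases g) (simp_all del: enc_nat.simps)
qed

lemma is_circuit_iff: "is_circuit x \<longleftrightarrow> (\<exists>C :: circuit. x = enc C)"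
  unfolding is_circuit_def enc_list_def
  using enc_list_iff[OF is_gate_iff, of x] by (simp add: enc_gate_def[abs_def])

lemma enc_gate_inj: "enc_gate g = enc_gate h \<longleftrightarrow> g = h"
  by (cases g; cases h; simp add: enc_list_eq_iff list.rel_eq numeral_2_eq_2 numeral_3_eq_3 del: enc_nat_inj;
      auto simp: list.rel_eq)

lemma enc_circuit_inj: "enc (C :: circuit) = enc D \<longleftrightarrow> C = D"
  by (simp add: enc_list_def enc_list_eq_iff enc_gate_def enc_gate_inj list.rel_eq)

text \<open>On encodings of circuits this is the identity at the level of trees. A malformed tree
  becomes the empty circuit, which is not well-formed.\<close>

definition parse :: "data \<Rightarrow> circuit" where
  "parse x = (if is_circuit x then THE C. enc C = x else [])"

lemma parse_enc [simp]: "parse (enc C) = C"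
  using is_circuit_iff enc_circuit_inj by (auto simp: parse_def)

lemma ptime_is_number: "ptime f \<Longrightarrow> ptime (\<lambda>x. is_number (f x))"
  unfolding is_number_def by (intro ptime_all ptime_null ptime_components ptime_snd ptime_id)

lemma ptime_is_circuit: "ptime f \<Longrightarrow> ptime (\<lambda>x. is_circuit (f x))"
  unfolding is_circuit_def is_gate_def
  by (intro ptime_basic ptime_is_number ptime_components ptime_left ptime_right)

lemma ptime_parse: "ptime f \<Longrightarrow> ptime (\<lambda>x. parse (f x))"
proof -
  assume f: "ptime f"
  have "ptime (\<lambda>x. if is_circuit (f x) then f x else Lf)"
    by (intro ptime_If ptime_is_circuit ptime_const f)
  then show ?thesis
  proof (rule ptime_enc_cong)
    show "enc (if is_circuit (f x) then f x else Lf) = enc (parse (f x))" for x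
      using is_circuit_iff by (cases "is_circuit (f x)") (auto simp: enc_data_def parse_def[of "f x"] enc_circuit_inj)
  qed
qed

subsection \<open>Checking circuits\<close>

lemma ptime_gate_tag: "ptime f \<Longrightarrow> ptime (\<lambda>x. gate_tag (f x))"
proof (rule ptime_expr_comp[of f "Left (Var 0)" gate_tag])
  show "eval (Left (Var 0)) s = enc (gate_tag g)" if "s 0 = enc g" for s g
    using that by (cases g) (auto simp: enc_gate_def enc_nat_def)
qed

lemma ptime_preds:
  assumes "ptime f" shows "ptime (\<lambda>x. preds (f x))"
proof -
  \<comment> \<open>A negation stores its predecessor as a bare number, so only there a list has to
    be built around it.\<close>
  have "ptime (\<lambda>x. if gate_tag (f x) = 1 then [right (enc (f x))] else components (right (enc (f x))))"
    by (intro ptime_basic ptime_Cons ptime_gate_tag ptime_right ptime_enc ptime_components assms)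
  then show ?thesis
  proof (rule ptime_enc_cong)
    have [simp]: "(enc :: nat \<Rightarrow> data) = enc_nat" by (simp add: fun_eq_iff enc_nat_def)
    show "enc (if gate_tag (f x) = 1 then [right (enc (f x))] else components (right (enc (f x)))) =
      enc (preds (f x))" for x
      by (cases "f x") (auto simp: enc_gate_def enc_data_def enc_list_def[where 'a = nat])
  qed
qed

lemma fan_in_ok_iff: "fan_in_ok g \<longleftrightarrow> gate_tag g < 2 \<or> 2 \<le> length (preds g)"
  by (cases g) auto

lemma wf_circuit_iff: "wf_circuit C \<longleftrightarrow> C \<noteq> [] \<and> (\<forall>i \<in> set [0..<length C].
    (gate_tag (nthd Input C i) < 2 \<or> 2 \<le> length (preds (nthd Input C i))) \<and>
    distinct (preds (nthd Input C i)) \<and> (\<forall>j \<in> set (preds (nthd Input C i)). j < i))"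
  unfolding wf_circuit_def fan_in_ok_iff by auto

lemma ptime_wf_circuit: "ptime f \<Longrightarrow> ptime (\<lambda>x. wf_circuit (f x))"
  unfolding wf_circuit_iff
  by (intro ptime_basic ptime_gate_tag ptime_preds; (erule ptime_comp)?; (intro ptime_basic)?)

text \<open>The recursion on \<open>d\<close> is unrolled outside the machine: each \<open>d\<close>
  has its own program, built from the programs for smaller depth.\<close>

lemma ptime_shallow:
  "ptime A \<Longrightarrow> ptime B \<Longrightarrow> ptime (\<lambda>x. shallow w d (A x) (B x))"
proof (rule ptime_app2[where F = "shallow w d"])
  show "ptime (\<lambda>z. shallow w d (fst z) (snd z))"
  proof (induction d arbitrary: w)
    case 0
    show ?case unfolding shallow.simps by (intro ptime_basic ptime_preds)
  next
    case (Suc d)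
    show ?case unfolding shallow.simps Let_def
      by (intro ptime_basic ptime_preds ptime_app2[OF Suc.IH])
  qed
qed

subsection \<open>Building the instance\<close>

lemma ptime_lit_refuted:
  assumes "ptime V" "ptime p" "ptime i" shows "ptime (\<lambda>x. lit_refuted (V x) (p x) (i x))"
  unfolding lit_refuted_def
  by (intro ptime_basic assms[THEN ptime_comp])

lemma ptime_refuted:
  "ptime A \<Longrightarrow> ptime B \<Longrightarrow> ptime G \<Longrightarrow> ptime P \<Longrightarrow> ptime I \<Longrightarrow>
    ptime (\<lambda>x. refuted d (A x) (B x) (G x) (P x) (I x))"
proof (rule ptime_app5[where F = "refuted d"])
  show "ptime (\<lambda>z. refuted d (fst z) (fst (snd z)) (fst (snd (snd z))) (fst (snd (snd (snd z))))
      (snd (snd (snd (snd z)))))"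
  proof (induction d)
    case 0
    show ?case unfolding refuted.simps by (intro ptime_basic ptime_lit_refuted)
  next
    case (Suc d)
    show ?case unfolding refuted.simps Let_def
      by (intro ptime_basic ptime_preds ptime_gate_tag ptime_lit_refuted ptime_app5[OF Suc.IH])
  qed
qed

lemma ptime_view_prefs:
  assumes "ptime M" "ptime V" "ptime A" shows "ptime (\<lambda>x. view_prefs (M x) (V x) (A x :: nat list))"
  unfolding view_prefs_def by (intro ptime_basic assms[THEN ptime_comp])

lemma ptime_view_code:
  assumes "ptime A" "ptime M" "ptime V"
  shows "ptime (\<lambda>x. view_code (A x :: nat list list) (M x) q (V x))"
  unfolding view_code_def by (intro ptime_basic ptime_view_prefs assms[THEN ptime_comp])

lemma ptime_gap_agents: "ptime f \<Longrightarrow> ptime (\<lambda>x. gap_agents d (f x))"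
  unfolding gap_agents_def by (intro ptime_basic)

lemma ptime_gap_views:
  assumes "ptime f" "ptime k" shows "ptime (\<lambda>x. gap_views d (f x) (k x))"
  unfolding gap_views_def view_ok_def compatible_def slot_ok_def
  by (intro ptime_basic ptime_gap_agents ptime_preds ptime_refuted assms[THEN ptime_comp])

text \<open>Membership in the source problem includes well-formedness, weft and depth, so these are
  tested first. The fallback \<open>Lf\<close> encodes no instance, since every
  \<open>enc_goa G\<close> is a branching node.\<close>

definition reduction :: "nat \<Rightarrow> data \<times> nat \<Rightarrow> data \<times> nat" where
  "reduction d z = (if is_circuit (fst z) \<and> wf_circuit (parse (fst z)) \<and>
       shallow 1 d (parse (fst z)) (length (parse (fst z)) - 1)
     then (enc (view_code (gap_agents d (parse (fst z))) (Suc (snd z)) (2 ^ d) (gap_views d (parse (fst z)) (snd z))),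
       Suc (snd z) + Suc (snd z) ^ 2 ^ d)
     else (Lf, 0))"

lemma ptime_reduction: "ptime (reduction d)"
  unfolding reduction_def[abs_def]
  by (intro ptime_basic ptime_is_circuit ptime_wf_circuit ptime_parse ptime_shallow ptime_enc ptime_view_code
    ptime_gap_agents ptime_gap_views)

lemma reduction_correct:
  assumes "1 \<le> d"
  shows "reduction d (x, k) \<in> globally_optimal_assignment \<longleftrightarrow> (x, k) \<in> weighted_circuit_sat 1 d"
proof (cases "\<exists>C. x = enc C \<and> wf_circuit C \<and> shallow 1 d C (output_node C)")
  case True
  then obtain C where C: "x = enc C" "wf_circuit C" "shallow 1 d C (output_node C)" by blast
  have x: "x = enc_list enc_gate C"
    using C(1) by (simp add: enc_list_def enc_gate_def[abs_def])
  have "is_circuit x" using C(1) is_circuit_iff by blast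
  then have "reduction d (x, k) = (enc (view_code (gap_agents d C) (Suc k) (2 ^ d) (gap_views d C k)),
      Suc k + Suc k ^ 2 ^ d)"
    using C by (simp add: reduction_def output_node_def)
  also have "\<dots> \<in> globally_optimal_assignment \<longleftrightarrow> (\<exists>A. labelling (Suc k) (2 ^ d) (gap_views d C k) A)"
  proof (rule view_code_iff)
    show "distinct (gap_agents d C)" "distinct (gap_views d C k)"
      unfolding gap_agents_def gap_views_def
      by (intro distinct_n_lists distinct_filter distinct_product distinct_upt)+
  qed (use two_le_pow[OF C(2,3) assms] in \<open>auto simp: set_gap_views[OF C(2,3) assms] view_ok_def compatible_def\<close>)
  also have "\<dots> \<longleftrightarrow> weighted_satisfiable C k"
    using labelling_satisfiable[OF C(2,3) assms] satisfiable_labelling[OF C(2,3) assms] by blast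
  also have "\<dots> \<longleftrightarrow> (x, k) \<in> weighted_circuit_sat 1 d"
  proof -
    have "C = D" if "x = enc_list enc_gate D" for D
      using that x by (simp add: enc_list_eq_iff enc_gate_inj list.rel_eq)
    then show ?thesis
      using x C(2,3) shallow_output_iff[OF C(2)] by (auto simp: weighted_circuit_sat_def)
  qed
  finally show ?thesis .
next
  case False
  have "\<not> (is_circuit x \<and> wf_circuit (parse x) \<and> shallow 1 d (parse x) (length (parse x) - 1))"
    using False is_circuit_iff by (auto simp: output_node_def)
  then have "reduction d (x, k) = (Lf, 0)" by (auto simp: reduction_def)
  moreover have "(Lf, 0) \<notin> globally_optimal_assignment"
    by (auto simp: globally_optimal_assignment_def enc_goa_def)
  moreover have "(x, k) \<notin> weighted_circuit_sat 1 d"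
    using False shallow_output_iff
    by (auto simp: weighted_circuit_sat_def enc_list_def enc_gate_def[abs_def])
  ultimately show ?thesis by simp
qed

section \<open>Composition of reductions\<close>

text \<open>The bounds of a composed reduction depend both on the old bound and on the parameter
  itself, so \<open>n\<close> is kept next to \<open>f n\<close>.\<close>

lemma computable_ptime:
  assumes "computable f" and h: "ptime (\<lambda>z. h (fst z) (snd z))"
  shows "computable (\<lambda>n. h (f n) n)"
proof -
  obtain c where c: "\<And>n. \<exists>t. computes_in c (enc_nat n) t (enc_nat (f n))"
    using assms(1) unfolding computable_def by blast
  obtain c0 N0 where c0: "\<And>n :: nat. \<exists>t. does c0 N0 (enc n) t (enc n)"
    using ptime_id[where 'a = nat] unfolding ptime_def by blast
  obtain c' N' where c': "\<And>z. \<exists>t. does c' N' (enc z) t (enc (h (fst z) (snd z)))"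
    using h unfolding ptime_def by blast
  let ?c = "Seq c (reset (com_bound c))" and ?N = "Suc (com_bound c)"
  have "\<exists>t. computes_in (Seq (pair_com (Suc (max ?N N0)) ?c c0) c') (enc_nat n) t (enc_nat (h (f n) n))" for n
  proof -
    obtain t where "computes_in c (enc_nat n) t (enc_nat (f n))" using c by blast
    from computes_does[OF this] obtain t where t: "does ?c ?N (enc_nat n) t (enc_nat (f n))" by blast
    obtain t0 where t0: "does c0 N0 (enc_nat n) t0 (enc_nat n)" using c0[of n] by (auto simp: enc_nat_def)
    obtain t' where t': "does c' N' (Br (enc_nat (f n)) (enc_nat n)) t' (enc_nat (h (f n) n))"
      using c'[of "(f n, n)"] by (auto simp: enc_nat_def)
    show ?thesis
      using does_computes[OF does_seq[OF does_pair[OF t t0] t']] by blast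
  qed
  then show ?thesis unfolding computable_def by blast
qed

text \<open>The intermediate instance is no larger than the time spent plus the input size, and a
  power of \<open>f k * tsize x ^ e\<close> again splits into a factor in \<open>k\<close> and a
  power of \<open>tsize x\<close>. Monotonicity of \<open>G\<close> is needed because the
  intermediate parameter is only bounded by \<open>g k\<close>.\<close>

lemma fpt_reducible_ptime:
  assumes "P \<le>\<^sub>f\<^sub>p\<^sub>t Q" and R: "ptime R" and correct: "\<And>x k. R (x, k) \<in> Q' \<longleftrightarrow> (x, k) \<in> Q"
    and param: "\<And>x k. snd (R (x, k)) \<le> G k" and G: "ptime G" "mono G"
  shows "P \<le>\<^sub>f\<^sub>p\<^sub>t Q'"
proof -
  obtain c f g e where f: "computable f" and g: "computable g"
    and red: "\<And>x k. \<exists>x' k' t. computes_in c (Br x (enc_nat k)) t (Br x' (enc_nat k')) \<and>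
        t \<le> f k * tsize x ^ e \<and> k' \<le> g k \<and> ((x, k) \<in> P \<longleftrightarrow> (x', k') \<in> Q)"
    using assms(1) unfolding fpt_reducible_def by blast
  obtain c' N T where T: "polyb T" "\<And>z. \<exists>t \<le> T z. does c' N (enc z) t (enc (R z))"
    using R unfolding ptime_def by blast
  obtain e' where e': "\<And>z. T z \<le> (tsize (enc z) + 2) ^ e'"
    using T(1) unfolding polyb_def by blast
  define b where "b = 1 + 2 * com_bound c"
  \<comment> \<open>The first summand pays for the given reduction and its cleaning, the second for
    \<open>R\<close>. The term \<open>k + k\<close> stems from the unary parameter; the 5 is an
    additive 4 plus 1 for the summand \<open>tsize x\<close>.\<close>
  define F where "F n k = (n + b) + (n + b + (k + k) + 5) ^ e'" for n k
  have "ptime (\<lambda>z. F (fst z) (snd z))"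
    unfolding F_def by (intro ptime_basic)
  then have F: "computable (\<lambda>k. F (f k) k)" by (rule computable_ptime[OF f])
  have G': "computable (\<lambda>k. G (g k))"
    by (rule computable_ptime[OF g, where h = "\<lambda>n _. G n"]) (intro ptime_comp[OF G(1)] ptime_fst ptime_id)
  show ?thesis
    unfolding fpt_reducible_def
  proof (rule exI[of _ "Seq (Seq c (reset (com_bound c))) c'"], rule exI[of _ "\<lambda>k. F (f k) k"],
      rule exI[of _ "\<lambda>k. G (g k)"], rule exI[of _ "Suc e * Suc e'"], intro conjI allI)
    show "computable (\<lambda>k. F (f k) k)" "computable (\<lambda>k. G (g k))" by (fact F G')+
  next
    fix x k
    obtain x1 k1 t1 where r: "computes_in c (Br x (enc_nat k)) t1 (Br x1 (enc_nat k1))"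
      "t1 \<le> f k * tsize x ^ e" "k1 \<le> g k" "(x, k) \<in> P \<longleftrightarrow> (x1, k1) \<in> Q"
      using red by blast
    have d1: "does (Seq c (reset (com_bound c))) (Suc (com_bound c)) (Br x (enc_nat k)) (t1 + b) (Br x1 (enc_nat k1))"
      using computes_does[OF r(1)] by (simp add: b_def)
    obtain x2 k2 where R2: "R (x1, k1) = (x2, k2)" by (cases "R (x1, k1)")
    obtain t2 where t2: "t2 \<le> T (x1, k1)" "does c' N (Br x1 (enc_nat k1)) t2 (Br x2 (enc_nat k2))"
      using T(2)[of "(x1, k1)"] by (auto simp: R2 enc_data_def enc_nat_def)
    let ?X = "tsize x"
    have X: "1 \<le> ?X" by (simp add: Suc_le_eq)
    have "tsize (Br x1 (enc_nat k1)) \<le> (t1 + b) + tsize (Br x (enc_nat k))"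
      by (rule does_size[OF d1])
    moreover have "tsize (enc_nat k) = k + k + 1" using tsize_enc_nat[of k] by (simp add: enc_nat_def)
    ultimately have size: "tsize (Br x1 (enc_nat k1)) + 2 \<le> (t1 + b) + ?X + (k + k) + 4" by simp
    have Xe: "1 \<le> ?X ^ e" using X by simp
    have tb: "t1 + b \<le> (f k + b) * ?X ^ e"
    proof -
      have "b * 1 \<le> b * ?X ^ e" using Xe by (rule mult_le_mono2)
      then show ?thesis using r(2) unfolding distrib_right by linarith
    qed
    have "(t1 + b) + ?X + (k + k) + 4 \<le> (f k + b + (k + k) + 5) * ?X ^ Suc e"
    proof -
      have X': "?X ^ e \<le> ?X ^ Suc e" "?X \<le> ?X ^ Suc e" "1 \<le> ?X ^ Suc e"
        using X Xe mult_le_mono1[OF X, of "?X ^ e"] mult_le_mono2[OF Xe, of ?X] by auto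
      have "(t1 + b) + ?X + ((k + k) + 4) * 1 \<le>
          (f k + b) * ?X ^ Suc e + ?X ^ Suc e + ((k + k) + 4) * ?X ^ Suc e"
        by (intro add_mono le_trans[OF tb mult_le_mono2[OF X'(1)]] X'(2) mult_le_mono2[OF X'(3)])
      then have "(t1 + b) + ?X + (k + k) + 4 \<le>
          (f k + b) * ?X ^ Suc e + ?X ^ Suc e + ((k + k) + 4) * ?X ^ Suc e"
        by simp
      also have "\<dots> = (f k + b + (k + k) + 5) * ?X ^ Suc e" by (simp add: algebra_simps)
      finally show ?thesis .
    qed
    with size have "tsize (Br x1 (enc_nat k1)) + 2 \<le> (f k + b + (k + k) + 5) * ?X ^ Suc e"
      by linarith
    then have "(tsize (Br x1 (enc_nat k1)) + 2) ^ e' \<le> ((f k + b + (k + k) + 5) * ?X ^ Suc e) ^ e'"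
      by (rule power_mono) simp
    also have "\<dots> = (f k + b + (k + k) + 5) ^ e' * ?X ^ (Suc e * e')"
      by (simp only: power_mult_distrib power_mult)
    also have "\<dots> \<le> (f k + b + (k + k) + 5) ^ e' * ?X ^ (Suc e * Suc e')"
      using X by (intro mult_le_mono2 power_increasing) auto
    finally have "t2 \<le> (f k + b + (k + k) + 5) ^ e' * ?X ^ (Suc e * Suc e')"
      using t2(1) e'[of "(x1, k1)"] by (simp add: enc_data_def enc_nat_def)
    moreover have "(f k + b) * ?X ^ e \<le> (f k + b) * ?X ^ (Suc e * Suc e')"
      using X by (intro mult_le_mono2 power_increasing) auto
    ultimately have time: "(t1 + b) + t2 \<le> F (f k) k * ?X ^ (Suc e * Suc e')"
      using tb unfolding F_def distrib_right by linarith
    have "k2 \<le> G (g k)"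
      using param[of x1 k1] R2 monoD[OF G(2) r(3)] by simp
    moreover have "(x, k) \<in> P \<longleftrightarrow> (x2, k2) \<in> Q'"
      using r(4) correct[of x1 k1] R2 by simp
    ultimately show "\<exists>x' k' t. computes_in (Seq (Seq c (reset (com_bound c))) c') (Br x (enc_nat k)) t (Br x' (enc_nat k')) \<and>
        t \<le> F (f k) k * tsize x ^ (Suc e * Suc e') \<and> k' \<le> G (g k) \<and> ((x, k) \<in> P \<longleftrightarrow> (x', k') \<in> Q')"
      using does_computes[OF does_seq[OF d1 t2(2)]] time by blast
  qed
qed

theorem theorem7: "W_hard 1 globally_optimal_assignment"
  unfolding W_hard_def
proof
  fix P assume "P \<in> W_class 1"
  then obtain d where d: "1 \<le> d" "P \<le>\<^sub>f\<^sub>p\<^sub>t weighted_circuit_sat 1 d"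
    unfolding W_class_def by blast
  let ?G = "\<lambda>k. Suc k + Suc k ^ 2 ^ d"
  show "P \<le>\<^sub>f\<^sub>p\<^sub>t globally_optimal_assignment"
  proof (rule fpt_reducible_ptime[OF d(2) ptime_reduction reduction_correct[OF d(1)]])
    show "snd (reduction d (x, k)) \<le> ?G k" for x k by (simp add: reduction_def)
    show "ptime ?G" by (intro ptime_basic)
    show "mono ?G" by (intro monoI add_mono power_mono) auto
  qed
qed

end
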